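(* Let $\mathbb{K}$ be a field, $S=\mathbb{K}[x_1,\dots,x_n]$, and let $I$ be a monomial ideal of $S$. Assume that $I=Q_1\cap\cdots\cap Q_s$, $s\ge 2$, is the unique irredundant presentation of $I$ as an intersection of irreducible monomial ideals. Suppose that for every $1\le i\le s$ and every proper nonempty subset $\tau\subset[s]=\{1,\dots,s\}$ with $$\sqrt{Q_i}\subseteq\sum_{j\in\tau}\sqrt{Q_j}$$ we have $$Q_i\subseteq\sum_{j\in\tau}Q_j.$$ Then $\mathrm{sdepth}(S/I)\ge\mathrm{size}_S(I)$.
   Context: A monomial ideal is irreducible iff it is generated by pure powers of variables; every monomial ideal has a unique irredundant presentation as an intersection of irreducible monomial ideals. Size: let $I$ be a monomial ideal of $S=\mathbb{K}[x_1,\dots,x_n]$ and let $I=\bigcap_{j=1}^sQ_j$ be an irredundant primary decomposition of $I$ with each $Q_j$ a monomial ideal. Let $h$ be the height of $\sum_{j=1}^sQ_j$ and let $v$ be the minimum number $t$ such that there exist $1\le j_1,\dots,j_t\le s$ with $\sqrt{\sum_{i=1}^tQ_{j_i}}=\sqrt{\sum_{j=1}^sQ_j}$. Then $\mathrm{size}_S(I)=v+n-h-1$. Stanley depth: let $M$ be a nonzero finitely generated $\mathbb{Z}^n$-graded $S$-module. For a homogeneous $u\in M$ and $Z\subseteq\{x_1,\dots,x_n\}$, the $\mathbb{K}$-subspace $u\mathbb{K}[Z]$ generated by all $uv$ with $v\in\mathbb{K}[Z]$ is called a Stanley space of dimension $|Z|$ if it is a free $\mathbb{K}[Z]$-module.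 A Stanley decomposition $\mathcal{D}$ of $M$ is a decomposition of $M$, as a $\mathbb{K}$-vector space, into a finite direct sum of Stanley spaces; $\mathrm{sdepth}(\mathcal{D})$ is the minimum dimension of a Stanley space in $\mathcal{D}$, and $\mathrm{sdepth}(M)$ is the maximum of $\mathrm{sdepth}(\mathcal{D})$ over all Stanley decompositions $\mathcal{D}$ of $M$. *)

theory Defs
  imports
    "HOL-Algebra.Algebra"
    "HOL-Algebra.Algebraic_Closure_Type"
    "HOL-Library.Cardinality"
    "HOL-Library.Poly_Mapping"
    "HOL-Library.Extended_Real"
begin

text \<open>
  The variables of the polynomial ring are the elements of a finite type \<^typ>\<open>'n\<close>, so the number
  \<open>n\<close> of variables is \<open>CARD('n)\<close>.  A monomial is given by its exponent vector, a polynomial is a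
  finitely supported map from exponent vectors to the field, and multiplication is convolution.
\<close>

type_synonym ('n, 'k) mpoly = "('n \<Rightarrow>\<^sub>0 nat) \<Rightarrow>\<^sub>0 'k"

abbreviation poly_ring :: "('n::finite, 'k::field) mpoly ring"  (\<open>\<S>\<close>)
  where "\<S> \<equiv> ring_of_type_algebra"

definition monomial :: "('n::finite \<Rightarrow>\<^sub>0 nat) \<Rightarrow> ('n, 'k::field) mpoly"
  where "monomial m = Poly_Mapping.single m 1"

definition var_power :: "'n::finite \<Rightarrow> nat \<Rightarrow> ('n, 'k::field) mpoly"
  where "var_power i a = monomial (Poly_Mapping.single i a)"

text \<open>The carrier of the subring \<open>K[Z]\<close>.\<close>
definition poly_subring :: "'n::finite set \<Rightarrow> ('n, 'k::field) mpoly set"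
  where "poly_subring Z = {p. \<forall>m\<in>Poly_Mapping.keys p. Poly_Mapping.keys m \<subseteq> Z}"


subsection \<open>Ideals\<close>

definition ideal_sum :: "('a, 'c) ring_scheme \<Rightarrow> ('i \<Rightarrow> 'a set) \<Rightarrow> 'i set \<Rightarrow> 'a set"
  where "ideal_sum R Q J = Idl\<^bsub>R\<^esub> (\<Union>j\<in>J. Q j)"

definition ideal_radical :: "('a, 'c) ring_scheme \<Rightarrow> 'a set \<Rightarrow> 'a set"
  where "ideal_radical R I = {a \<in> carrier R. \<exists>k::nat. a [^]\<^bsub>R\<^esub> k \<in> I}"

definition primary_ideal :: "('a, 'c) ring_scheme \<Rightarrow> 'a set \<Rightarrow> bool"
  where "primary_ideal R I \<longleftrightarrow> ideal I R \<and> I \<noteq> carrier R \<and>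
    (\<forall>a\<in>carrier R. \<forall>b\<in>carrier R. a \<otimes>\<^bsub>R\<^esub> b \<in> I \<longrightarrow> a \<in> I \<or> b \<in> ideal_radical R I)"

definition prime_height :: "('a, 'c) ring_scheme \<Rightarrow> 'a set \<Rightarrow> enat"
  where "prime_height R P =
    (SUP k\<in>{k. \<exists>C :: nat \<Rightarrow> 'a set. (\<forall>i\<le>k. primeideal (C i) R) \<and> (\<forall>i<k. C i \<subset> C (Suc i)) \<and> C k = P}.
       enat k)"

definition height :: "('a, 'c) ring_scheme \<Rightarrow> 'a set \<Rightarrow> enat"
  where "height R I = (INF P\<in>{P. primeideal P R \<and> I \<subseteq> P}. prime_height R P)"

definition monomial_ideal :: "('n::finite, 'k::field) mpoly set \<Rightarrow> bool"
  where "monomial_ideal I \<longleftrightarrow> (\<exists>A. I = Idl\<^bsub>\<S>\<^esub> (monomial ` A))"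

text \<open>
  Irreducible monomial ideals are those generated by pure powers \<open>x\<^sub>i\<^sup>a\<close> of variables.  Exponents are
  positive, so that these ideals are proper; the zero ideal is included.
\<close>
definition irreducible_monomial_ideal :: "('n::finite, 'k::field) mpoly set \<Rightarrow> bool"
  where "irreducible_monomial_ideal I \<longleftrightarrow>
    (\<exists>P. (\<forall>(i, a)\<in>P. a \<ge> 1) \<and> I = Idl\<^bsub>\<S>\<^esub> ((\<lambda>(i, a). var_power i a) ` P))"

definition irredundant_presentation :: "nat \<Rightarrow> (nat \<Rightarrow> 'a set) \<Rightarrow> 'a set \<Rightarrow> bool"
  where "irredundant_presentation s Q I \<longleftrightarrow>
    I = (\<Inter>j\<in>{1..s}. Q j) \<and> (\<forall>i\<in>{1..s}. (\<Inter>j\<in>{1..s} - {i}. Q j) \<noteq> I)"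


subsection \<open>Size\<close>

definition monomial_primary_decomposition ::
    "nat \<Rightarrow> (nat \<Rightarrow> ('n::finite, 'k::field) mpoly set) \<Rightarrow> ('n, 'k) mpoly set \<Rightarrow> bool"
  where "monomial_primary_decomposition s Q I \<longleftrightarrow>
    s \<ge> 1 \<and> (\<forall>j\<in>{1..s}. monomial_ideal (Q j) \<and> primary_ideal \<S> (Q j)) \<and>
    irredundant_presentation s Q I"

definition size_v :: "nat \<Rightarrow> (nat \<Rightarrow> ('n::finite, 'k::field) mpoly set) \<Rightarrow> nat"
  where "size_v s Q = (LEAST t. t \<ge> 1 \<and> (\<exists>j :: nat \<Rightarrow> nat. j ` {1..t} \<subseteq> {1..s} \<and>
    ideal_radical \<S> (ideal_sum \<S> (\<lambda>i. Q (j i)) {1..t}) = ideal_radical \<S> (ideal_sum \<S> Q {1..s})))"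

definition decomposition_size :: "nat \<Rightarrow> (nat \<Rightarrow> ('n::finite, 'k::field) mpoly set) \<Rightarrow> ereal"
  where "decomposition_size s Q =
    ereal (real (size_v s Q)) + ereal (real CARD('n)) - ereal_of_enat (height \<S> (ideal_sum \<S> Q {1..s})) - 1"

text \<open>
  The number \<open>v + n - h - 1\<close> does not depend on the chosen decomposition, because the set of
  radicals of the components is the set of associated primes of \<open>S/I\<close>.  It is an extended real
  only because heights are of type \<^typ>\<open>enat\<close>.
\<close>
definition ideal_size :: "('n::finite, 'k::field) mpoly set \<Rightarrow> ereal"
  where "ideal_size I =
    (THE z. \<exists>s Q. monomial_primary_decomposition s Q I \<and> z = decomposition_size s Q)"


subsection \<open>Stanley depth\<close>

text \<open>
  Uniqueness of the coefficient family \<open>c\<close> (extended by \<^const>\<open>undefined\<close> outside \<open>B\<close>) expresses that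
  \<open>B\<close> is a basis.
\<close>
definition free_module :: "('a, 'c) ring_scheme \<Rightarrow> ('a, 'm, 'd) module_scheme \<Rightarrow> bool"
  where "free_module R M \<longleftrightarrow> module R M \<and>
    (\<exists>B\<subseteq>carrier M. \<forall>x\<in>carrier M. \<exists>!c. c \<in> B \<rightarrow>\<^sub>E carrier R \<and>
       finite {b\<in>B. c b \<noteq> \<zero>\<^bsub>R\<^esub>} \<and>
       x = (\<Oplus>\<^bsub>M\<^esub>b\<in>{b\<in>B. c b \<noteq> \<zero>\<^bsub>R\<^esub>}. c b \<odot>\<^bsub>M\<^esub> b))"

text \<open>
  In what follows, a \<open>\<int>\<^sup>n\<close>-graded module over the polynomial ring is given by a module \<open>M\<close> and its
  family \<open>G\<close> of homogeneous components, indexed by the degrees \<^typ>\<open>'n \<Rightarrow> int\<close>.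
\<close>

definition stanley_carrier ::
    "(('n::finite, 'k::field) mpoly, 'm, 'd) module_scheme \<Rightarrow> 'm \<Rightarrow> 'n set \<Rightarrow> 'm set"
  where "stanley_carrier M u Z = (\<lambda>p. p \<odot>\<^bsub>M\<^esub> u) ` poly_subring Z"

definition stanley_space ::
    "(('n::finite, 'k::field) mpoly, 'm, 'd) module_scheme \<Rightarrow> (('n \<Rightarrow> int) \<Rightarrow> 'm set) \<Rightarrow> 'm \<Rightarrow> 'n set \<Rightarrow> bool"
  where "stanley_space M G u Z \<longleftrightarrow> u \<in> carrier M \<and> (\<exists>d. u \<in> G d) \<and>
    free_module (\<S>\<lparr>carrier := poly_subring Z\<rparr>) (M\<lparr>carrier := stanley_carrier M u Z\<rparr>)"

text \<open>
  A list of pairs \<open>(u, Z)\<close> such that \<open>M\<close> is the internal direct sum of the spaces \<open>uK[Z]\<close>.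
\<close>
definition stanley_decomposition ::
    "(('n::finite, 'k::field) mpoly, 'm, 'd) module_scheme \<Rightarrow> (('n \<Rightarrow> int) \<Rightarrow> 'm set) \<Rightarrow>
     ('m \<times> 'n set) list \<Rightarrow> bool"
  where "stanley_decomposition M G D \<longleftrightarrow>
    (\<forall>(u, Z)\<in>set D. stanley_space M G u Z) \<and>
    (\<forall>x\<in>carrier M. \<exists>!f. f \<in> (\<Pi>\<^sub>E i\<in>{..<length D}. stanley_carrier M (fst (D ! i)) (snd (D ! i))) \<and>
       x = (\<Oplus>\<^bsub>M\<^esub>i\<in>{..<length D}. f i))"

definition sdepth_decomposition :: "('m \<times> 'n::finite set) list \<Rightarrow> nat"
  where "sdepth_decomposition D = Min ((\<lambda>(u, Z). card Z) ` set D)"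

definition sdepth ::
    "(('n::finite, 'k::field) mpoly, 'm, 'd) module_scheme \<Rightarrow> (('n \<Rightarrow> int) \<Rightarrow> 'm set) \<Rightarrow> nat"
  where "sdepth M G = Max {sdepth_decomposition D | D. stanley_decomposition M G D}"

definition quotient_module :: "('a, 'c) ring_scheme \<Rightarrow> 'a set \<Rightarrow> ('a, 'a set) module"
  where "quotient_module R I =
    \<lparr>carrier = carrier (R Quot I), monoid.mult = monoid.mult (R Quot I), one = \<one>\<^bsub>R Quot I\<^esub>,
     ring.zero = \<zero>\<^bsub>R Quot I\<^esub>, add = add (R Quot I),
     module.smult = (\<lambda>r C. (I +>\<^bsub>R\<^esub> r) \<otimes>\<^bsub>R Quot I\<^esub> C)\<rparr>"

text \<open>The component of degree \<open>d\<close> is zero if some entry of \<open>d\<close> is negative.\<close>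
definition poly_component :: "('n::finite \<Rightarrow> int) \<Rightarrow> ('n, 'k::field) mpoly set"
  where "poly_component d =
    {p. \<forall>m\<in>Poly_Mapping.keys p. \<forall>i. int (Poly_Mapping.lookup m i) = d i}"

definition quotient_component ::
    "('n::finite, 'k::field) mpoly set \<Rightarrow> ('n \<Rightarrow> int) \<Rightarrow> ('n, 'k) mpoly set set"
  where "quotient_component I d = (\<lambda>p. I +>\<^bsub>\<S>\<^esub> p) ` poly_component d"

definition sdepth_quotient :: "('n::finite, 'k::field) mpoly set \<Rightarrow> nat"
  where "sdepth_quotient I = sdepth (quotient_module \<S> I) (quotient_component I)"

lemma quotient_module_is_module:
  assumes "cring R" "ideal I R"
  shows "module R (quotient_module R I)"
proof -
  interpret R: cring R by fact
  interpret I: ideal I R by fact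
  interpret Q: cring "R Quot I" by (rule I.quotient_is_cring) fact
  interpret h: ring_hom_ring R "R Quot I" "(+>\<^bsub>R\<^esub>) I" by (rule I.rcos_ring_hom_ring)
  let ?M = "quotient_module R I"
  have ag: "abelian_group ?M"
  proof (rule abelian_groupI)
    fix x assume "x \<in> carrier ?M"
    then show "\<exists>y\<in>carrier ?M. y \<oplus>\<^bsub>?M\<^esub> x = \<zero>\<^bsub>?M\<^esub>"
      using Q.l_neg Q.a_inv_closed unfolding quotient_module_def by auto
  qed (auto simp: quotient_module_def Q.a_ac)
  show ?thesis
    by (rule moduleI[OF R.is_cring ag])
       (auto simp: quotient_module_def Q.l_distr Q.r_distr Q.m_assoc)
qed

end

theory Submission
  imports Defs
begin

text \<open>
  A partition of the monomials outside \<open>I\<close> into finitely many cones \<open>u \<sqdot> Mon(Z)\<close> is a Stanley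
  decomposition of \<open>S/I\<close>, so it suffices to find one with all \<open>card Z \<ge> v + n - h - 1\<close>.  Fix a
  component \<open>Q\<^sub>t\<close> and split the monomials according to the set \<open>\<sigma>\<close> of components \<open>Q\<^sub>j\<close> that do not
  contain the part of the monomial in the variables of \<open>Q\<^sub>t\<close>.  If \<open>t \<in> \<sigma>\<close>, that part ranges over a finite set and
  all other variables are free.  If \<open>t \<notin> \<sigma>\<close>, the slice is a product: the factor in the remaining
  variables is treated by induction, and the factor in the variables of \<open>Q\<^sub>t\<close> is empty or contributes
  at least one dimension.  Indeed, if every variable of \<open>Q\<^sub>t\<close> occurs in a component of \<open>\<sigma>\<close>, then
  \<open>Q\<^sub>t \<subseteq> \<Sum>\<^bsub>j\<in>\<sigma>\<^esub> Q\<^sub>j\<close> by hypothesis, which contradicts \<open>t \<notin> \<sigma>\<close>; otherwise multiplication by a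
  missing variable preserves the factor.  The extra dimension pays for adding \<open>t\<close> to a cover of the
  variables by components.
\<close>

subsection \<open>Partitions into cones\<close>

text \<open>The obstacle is that the induction leaves the class of irredundant decompositions:
  deleting the variables of component t from a subfamily can create repeated, redundant or zero
  components. The induction therefore carries only variable sets, exponents and the inequality d + 1
  + card U \<le> card \<sigma> + card V for every nonempty subfamily \<sigma> that uses all
  variables U of the family. With all n variables in V and h = card U this says d \<le> v + n - h -
  1. The hypothesis on radicals survives because a subfamily is enlarged by t before it is applied,
  and t never provides the required power: the deleted variables are exactly those of t. On the side
  of the size, the definite description in \<open>ideal_size\<close> calls for independence of the
  decomposition, and since h enters with a minus sign, a lower bound for the height suffices, namely
  the number of variables that occur.\<close>

definition exponent_cone :: "'n set \<Rightarrow> ('n \<Rightarrow> nat) \<times> 'n set \<Rightarrow> ('n \<Rightarrow> nat) set"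
  where "exponent_cone V c = {m. \<forall>k\<in>V. if k \<in> snd c then fst c k \<le> m k else m k = fst c k}"

definition cone_partition :: "'n set \<Rightarrow> nat \<Rightarrow> ('n \<Rightarrow> nat) set \<Rightarrow> (('n \<Rightarrow> nat) \<times> 'n set) set \<Rightarrow> bool"
  where "cone_partition V d R D \<longleftrightarrow> finite D \<and> (\<forall>c\<in>D. snd c \<subseteq> V \<and> d \<le> card (snd c)) \<and>
    R = (\<Union>c\<in>D. exponent_cone V c) \<and> pairwise (\<lambda>c c'. disjnt (exponent_cone V c) (exponent_cone V c')) D"

definition cone_partitionable :: "'n set \<Rightarrow> nat \<Rightarrow> ('n \<Rightarrow> nat) set \<Rightarrow> bool"
  where "cone_partitionable V d R \<longleftrightarrow> (\<exists>D. cone_partition V d R D)"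

lemma cone_partitionableI:
  assumes "finite D" "\<forall>c\<in>D. snd c \<subseteq> V \<and> d \<le> card (snd c)" "R = (\<Union>c\<in>D. exponent_cone V c)"
    "pairwise (\<lambda>c c'. disjnt (exponent_cone V c) (exponent_cone V c')) D"
  shows "cone_partitionable V d R"
  using assms unfolding cone_partitionable_def cone_partition_def by (intro exI[of _ D]) simp

lemma cone_partitionable_empty: "cone_partitionable V d {}"
  unfolding cone_partitionable_def cone_partition_def by (rule exI[of _ "{}"]) simp

lemma cone_partitionable_mono:
  "cone_partitionable V d R \<Longrightarrow> d' \<le> d \<Longrightarrow> cone_partitionable V d' R"
  unfolding cone_partitionable_def cone_partition_def by (erule ex_forward) auto

lemma cone_partitionable_Union:
  assumes "finite J" and part: "\<And>j. j \<in> J \<Longrightarrow> cone_partitionable V d (R j)"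
    and disj: "disjoint_family_on R J"
  shows "cone_partitionable V d (\<Union>j\<in>J. R j)"
proof -
  obtain D where D: "\<And>j. j \<in> J \<Longrightarrow> cone_partition V d (R j) (D j)"
    using part unfolding cone_partitionable_def by metis
  have sub: "exponent_cone V c \<subseteq> R j" if "j \<in> J" "c \<in> D j" for j c
    using D[OF that(1)] that(2) unfolding cone_partition_def by blast
  have "disjnt (exponent_cone V c) (exponent_cone V c')" if "j \<in> J" "c \<in> D j" "j' \<in> J" "c' \<in> D j'" "c \<noteq> c'" for j c j' c'
  proof (cases "j = j'")
    case True
    then show ?thesis
      using D[OF that(1)] that unfolding cone_partition_def pairwise_def by blast
  next
    case False
    then have "R j \<inter> R j' = {}"
      using disj that unfolding disjoint_family_on_def by blast
    then show ?thesis
      using sub that unfolding disjnt_def by blast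
  qed
  then have "pairwise (\<lambda>c c'. disjnt (exponent_cone V c) (exponent_cone V c')) (\<Union>j\<in>J. D j)"
    unfolding pairwise_def by blast
  moreover have "(\<Union>j\<in>J. R j) = (\<Union>c\<in>(\<Union>j\<in>J. D j). exponent_cone V c)"
    using D unfolding cone_partition_def by simp
  moreover have "finite (\<Union>j\<in>J. D j)" "\<forall>c\<in>(\<Union>j\<in>J. D j). snd c \<subseteq> V \<and> d \<le> card (snd c)"
    using D assms(1) unfolding cone_partition_def by auto
  ultimately show ?thesis by (intro cone_partitionableI[where D = "\<Union>j\<in>J. D j"]) auto
qed

lemma cone_partitionable_Un:
  assumes "cone_partitionable V d A" "cone_partitionable V d B" "A \<inter> B = {}"
  shows "cone_partitionable V d (A \<union> B)"
proof -
  have "cone_partitionable V d (\<Union>b\<in>UNIV. if b then A else B)"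
    by (rule cone_partitionable_Union) (use assms in \<open>auto simp: disjoint_family_on_def\<close>)
  then show ?thesis by (simp add: UNIV_bool Un_commute)
qed

text \<open>Cones over V constrain only the coordinates in V, so both sets are cylinders and their
  intersection is a product. Products of cones over disjoint variable sets are cones, and their
  dimensions add.\<close>

lemma cone_partitionable_inter:
  assumes A: "cone_partitionable V d A" and B: "cone_partitionable W e B"
    and disj: "V \<inter> W = {}" and fin: "finite V" "finite W"
  shows "cone_partitionable (V \<union> W) (d + e) (A \<inter> B)"
proof -
  obtain D where D: "cone_partition V d A D"
    using A unfolding cone_partitionable_def by blast
  obtain E where E: "cone_partition W e B E"
    using B unfolding cone_partitionable_def by blast
  define f :: "(('a \<Rightarrow> nat) \<times> 'a set) \<times> (('a \<Rightarrow> nat) \<times> 'a set) \<Rightarrow> ('a \<Rightarrow> nat) \<times> 'a set" where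
    "f = (\<lambda>(c, c'). (\<lambda>k. if k \<in> V then fst c k else fst c' k, snd c \<union> snd c'))"
  have cone_f: "exponent_cone (V \<union> W) (f (c, c')) = exponent_cone V c \<inter> exponent_cone W c'" if "c \<in> D" "c' \<in> E" for c c'
  proof -
    have "snd c \<subseteq> V" "snd c' \<subseteq> W"
      using D E that unfolding cone_partition_def by auto
    then have "k \<in> V \<Longrightarrow> k \<notin> snd c'" "k \<in> W \<Longrightarrow> k \<notin> snd c" "k \<in> W \<Longrightarrow> k \<notin> V" for k
      using disj by auto
    then show ?thesis
      unfolding exponent_cone_def f_def by (auto split: if_splits)
  qed
  have "disjnt (exponent_cone (V \<union> W) p) (exponent_cone (V \<union> W) p')" 
    if p: "p \<in> f ` (D \<times> E)" "p' \<in> f ` (D \<times> E)" "p \<noteq> p'" for p p'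
  proof -
    obtain c c' where c: "p = f (c, c')" "c \<in> D" "c' \<in> E" using p by auto
    obtain b b' where b: "p' = f (b, b')" "b \<in> D" "b' \<in> E" using p by auto
    have "c \<noteq> b \<or> c' \<noteq> b'" using p(3) c b by auto
    then have "disjnt (exponent_cone V c) (exponent_cone V b) \<or> disjnt (exponent_cone W c') (exponent_cone W b')"
      using D E c b unfolding cone_partition_def pairwise_def by blast
    then show ?thesis
      unfolding c(1) b(1) cone_f[OF c(2,3)] cone_f[OF b(2,3)] disjnt_def by blast
  qed
  then have "pairwise (\<lambda>c c'. disjnt (exponent_cone (V \<union> W) c) (exponent_cone (V \<union> W) c')) (f ` (D \<times> E))"
    unfolding pairwise_def by blast
  moreover have "A \<inter> B = (\<Union>c\<in>f ` (D \<times> E). exponent_cone (V \<union> W) c)"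
  proof -
    have "A = (\<Union>c\<in>D. exponent_cone V c)" "B = (\<Union>c\<in>E. exponent_cone W c)"
      using D E unfolding cone_partition_def by auto
    then show ?thesis using cone_f by fastforce
  qed
  moreover have "finite (f ` (D \<times> E))"
    using D E unfolding cone_partition_def by blast
  moreover have "snd p \<subseteq> V \<union> W \<and> d + e \<le> card (snd p)" if p: "p \<in> f ` (D \<times> E)" for p
  proof -
    obtain c c' where c: "p = f (c, c')" "c \<in> D" "c' \<in> E" using p by auto
    have *: "snd c \<subseteq> V" "snd c' \<subseteq> W" "d \<le> card (snd c)" "e \<le> card (snd c')"
      using D E c unfolding cone_partition_def by auto
    then have "card (snd c \<union> snd c') = card (snd c) + card (snd c')"
      using fin disj by (intro card_Un_disjoint) (auto intro: finite_subset)
    then show ?thesis using * c(1) by (auto simp: f_def)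
  qed
  ultimately show ?thesis by (intro cone_partitionableI[where D = "f ` (D \<times> E)"]) auto
qed

lemma cone_partitionable_UNIV: "cone_partitionable V (card V) UNIV"
  unfolding cone_partitionable_def cone_partition_def
  by (rule exI[of _ "{(\<lambda>_. 0, V)}"]) (auto simp: exponent_cone_def pairwise_def)

lemma cone_partitionable_box:
  assumes "finite V"
  shows "cone_partitionable V 0 {m. \<forall>k\<in>V. m k < a k}"
proof -
  define D where "D = (\<lambda>u. (u, {} :: 'a set)) ` (\<Pi>\<^sub>E k\<in>V. {..<a k})"
  have "finite D" unfolding D_def by (intro finite_imageI finite_PiE assms) auto
  moreover have "{m. \<forall>k\<in>V. m k < a k} = (\<Union>c\<in>D. exponent_cone V c)"
  proof (intro equalityI subsetI)
    fix m assume "m \<in> {m. \<forall>k\<in>V. m k < a k}"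
    then have "restrict m V \<in> (\<Pi>\<^sub>E k\<in>V. {..<a k})" by auto
    moreover have "m \<in> exponent_cone V (restrict m V, {})" by (simp add: exponent_cone_def)
    ultimately show "m \<in> (\<Union>c\<in>D. exponent_cone V c)" unfolding D_def by blast
  next
    fix m assume "m \<in> (\<Union>c\<in>D. exponent_cone V c)"
    then show "m \<in> {m. \<forall>k\<in>V. m k < a k}" unfolding D_def exponent_cone_def by (fastforce simp: PiE_iff)
  qed
  moreover have "pairwise (\<lambda>c c'. disjnt (exponent_cone V c) (exponent_cone V c')) D"
  proof (rule pairwiseI)
    fix c c' assume *: "c \<in> D" "c' \<in> D" "c \<noteq> c'"
    obtain u u' where u: "c = (u, {})" "c' = (u', {})"
        "u \<in> (\<Pi>\<^sub>E k\<in>V. {..<a k})" "u' \<in> (\<Pi>\<^sub>E k\<in>V. {..<a k})"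
      using * unfolding D_def by blast
    have "c = c'" if "m \<in> exponent_cone V c" "m \<in> exponent_cone V c'" for m
      using that u PiE_ext[OF u(3,4)] unfolding exponent_cone_def by simp
    then show "disjnt (exponent_cone V c) (exponent_cone V c')" using * unfolding disjnt_def by blast
  qed
  moreover have "\<forall>c\<in>D. snd c \<subseteq> V \<and> 0 \<le> card (snd c)" unfolding D_def by auto
  ultimately show ?thesis by (intro cone_partitionableI[where D = "D"]) auto
qed

text \<open>
  If membership in \<open>R\<close> does not change when exponents are capped at \<open>N\<close>, the lines in direction \<open>k\<close>
  can be grouped into finitely many cones, according to their capped other coordinates.
\<close>
lemma cone_partitionable_upward_closed:
  assumes fin: "finite V" and k: "k \<in> V"
    and cap: "\<And>m m'. (\<And>l. l \<in> V \<Longrightarrow> min (m l) N = min (m' l) N) \<Longrightarrow> m \<in> R \<longleftrightarrow> m' \<in> R"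
    and up: "\<And>m x. m \<in> R \<Longrightarrow> m k \<le> x \<Longrightarrow> m(k := x) \<in> R"
  shows "cone_partitionable V 1 R"
proof -
  \<comment> \<open>By \<open>up\<close> the values x with \<open>b(k := x)\<close> in R form an
    up-set, and \<open>h b\<close> is its least element.\<close>
  define h where "h = (\<lambda>b. LEAST x. b(k := x) \<in> R)"
  define B where "B = {b \<in> (\<Pi>\<^sub>E l\<in>V - {k}. {..N}). \<exists>x. b(k := x) \<in> R}"
  \<comment> \<open>A capped coordinate equal to N stands for all values from N on, so its direction
    is free. Direction k is always free, which gives dimension at least 1.\<close>
  define g where "g = (\<lambda>b. (b(k := h b), insert k {l \<in> V - {k}. b l = N}))"
  define r where "r = (\<lambda>m. restrict (\<lambda>l. min (m l) N) (V - {k}))"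
  have r_eq: "m \<in> R \<longleftrightarrow> (r m)(k := m k) \<in> R" for m
    by (rule cap) (auto simp: r_def)
  have cone_g: "m \<in> exponent_cone V (g b) \<longleftrightarrow> r m = b \<and> m \<in> R" if b: "b \<in> B" for b m
  proof -
    have bE: "b \<in> (\<Pi>\<^sub>E l\<in>V - {k}. {..N})" and ex: "\<exists>x. b(k := x) \<in> R"
      using b unfolding B_def by auto
    have least: "b(k := h b) \<in> R" unfolding h_def using ex by (rule LeastI_ex)
    have mem: "b(k := x) \<in> R \<longleftrightarrow> h b \<le> x" for x
      using up[OF least, of x] Least_le[of "\<lambda>x. b(k := x) \<in> R" x] by (auto simp: h_def)
    have "r m = b \<longleftrightarrow> (\<forall>l\<in>V - {k}. min (m l) N = b l)"
      using bE unfolding r_def by (auto simp: fun_eq_iff PiE_iff extensional_def)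
    also have "\<dots> \<longleftrightarrow> (\<forall>l\<in>V - {k}. if b l = N then N \<le> m l else m l = b l)"
    proof (rule ball_cong[OF refl])
      fix l assume "l \<in> V - {k}"
      then have "b l \<le> N" using bE by (auto simp: PiE_iff)
      then show "(min (m l) N = b l) = (if b l = N then N \<le> m l else m l = b l)"
        by (auto simp: min_def)
    qed
    finally have rm: "r m = b \<longleftrightarrow> (\<forall>l\<in>V - {k}. if b l = N then N \<le> m l else m l = b l)" .
    have split: "(\<forall>l\<in>V. Q l) \<longleftrightarrow> Q k \<and> (\<forall>l\<in>V - {k}. Q l)" for Q
      using k by auto
    have "m \<in> exponent_cone V (g b) \<longleftrightarrow> h b \<le> m k \<and> r m = b"
      unfolding rm exponent_cone_def mem_Collect_eq split by (simp add: g_def)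
    also have "\<dots> \<longleftrightarrow> r m = b \<and> m \<in> R"
      using mem r_eq[of m] by metis
    finally show ?thesis .
  qed
  have "finite B" unfolding B_def
    by (rule finite_subset[OF _ finite_PiE[of "V - {k}" "\<lambda>_. {..N}"]]) (use fin in auto)
  moreover have "R = (\<Union>c\<in>g ` B. exponent_cone V c)"
  proof (intro equalityI subsetI)
    fix m assume m: "m \<in> R"
    then have "r m \<in> B" unfolding B_def using r_eq[of m] by (auto simp: r_def)
    then show "m \<in> (\<Union>c\<in>g ` B. exponent_cone V c)" using cone_g m by blast
  next
    fix m assume "m \<in> (\<Union>c\<in>g ` B. exponent_cone V c)"
    then show "m \<in> R" using cone_g by blast
  qed
  moreover have "pairwise (\<lambda>c c'. disjnt (exponent_cone V c) (exponent_cone V c')) (g ` B)"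
  proof (rule pairwiseI)
    fix c c' assume "c \<in> g ` B" "c' \<in> g ` B" "c \<noteq> c'"
    then obtain b b' where "b \<in> B" "c = g b" "b' \<in> B" "c' = g b'" "b \<noteq> b'" by blast
    then show "disjnt (exponent_cone V c) (exponent_cone V c')"
      using cone_g[of b] cone_g[of b'] by (auto simp: disjnt_iff)
  qed
  moreover have "\<forall>c\<in>g ` B. snd c \<subseteq> V \<and> 1 \<le> card (snd c)"
    using fin k by (auto simp: g_def Suc_le_eq card_gt_0_iff)
  ultimately show ?thesis by (intro cone_partitionableI[where D = "g ` B"]) auto
qed

text \<open>
  An index \<open>j\<close> encodes the irreducible ideal generated by the \<open>a j k\<close>-th powers of the variables
  \<open>k \<in> P j\<close>; the set consists of the exponents of the monomials outside the intersection.
\<close>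
definition outside :: "'i set \<Rightarrow> ('i \<Rightarrow> 'n set) \<Rightarrow> ('i \<Rightarrow> 'n \<Rightarrow> nat) \<Rightarrow> ('n \<Rightarrow> nat) set"
  where "outside T P a = {m. \<exists>j\<in>T. \<forall>k\<in>P j. m k < a j k}"

text \<open>The fourth assumption is the containment of component i in the sum over \<sigma>, read
  off on generators. The last one spreads the bound on d over all covers instead of stating it for a
  least one, so that it can be transported to subfamilies.\<close>

lemma outside_partitionable:
  fixes P :: "'i \<Rightarrow> 'n set" and a :: "'i \<Rightarrow> 'n \<Rightarrow> nat"
  assumes "finite T" "finite V" "\<And>j. j \<in> T \<Longrightarrow> P j \<subseteq> V"
    and "\<And>i \<sigma>. i \<in> T \<Longrightarrow> \<sigma> \<subseteq> T \<Longrightarrow> P i \<subseteq> (\<Union>j\<in>\<sigma>. P j) \<Longrightarrow>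
           \<forall>k\<in>P i. \<exists>j\<in>\<sigma>. k \<in> P j \<and> a j k \<le> a i k"
    and "\<And>\<sigma>. \<sigma> \<subseteq> T \<Longrightarrow> \<sigma> \<noteq> {} \<Longrightarrow> (\<Union>j\<in>\<sigma>. P j) = (\<Union>j\<in>T. P j) \<Longrightarrow>
           d + 1 + card (\<Union>j\<in>T. P j) \<le> card \<sigma> + card V"
  shows "cone_partitionable V d (outside T P a)"
  using assms
proof (induction "card T" arbitrary: T V P d rule: less_induct)
  case less
  note fin = less.prems(1,2) and PV = less.prems(3) and hyp = less.prems(4) and cover = less.prems(5)
  show ?case
  proof (cases "T = {}")
    case True
    then show ?thesis by (simp add: outside_def cone_partitionable_empty)
  next
    case False
    then obtain t where t: "t \<in> T" by blast
    let ?U = "\<Union>j\<in>T. P j"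
    have finP: "finite (P j)" if "j \<in> T" for j using PV fin(2) that finite_subset by blast
    have finU: "finite ?U" using finP fin by blast
    define A where "A = (\<lambda>\<sigma>. {m. (\<exists>k\<in>P t. a t k \<le> m k) \<and>
      (\<forall>j\<in>T - {t}. j \<in> \<sigma> \<longleftrightarrow> (\<forall>k\<in>P j \<inter> P t. m k < a j k))})"
    \<comment> \<open>If \<open>P j\<close> lies inside \<open>P t\<close>, then \<open>P' j\<close>
      is empty and component j imposes no condition on the remaining variables, as for the zero
      ideal.\<close>
    define P' where "P' = (\<lambda>j. P j - P t)"
    define \<Sigma> where "\<Sigma> = {\<sigma>. \<sigma> \<subseteq> T - {t} \<and> \<sigma> \<noteq> {}}"
    define slice where "slice = (\<lambda>\<sigma>. A \<sigma> \<inter> outside \<sigma> P' a)"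
    define B where "B = {m. \<forall>k\<in>P t. m k < a t k}"
    \<comment> \<open>A cover inequality for families that need not cover: each variable missed by
      \<open>insert t \<sigma>\<close> is supplied by one further component, so completing the cover
      costs at most \<open>card (?U - ?W)\<close> components, which cancel against the missing
      variables. The summand 1 of \<open>cover\<close> pays for t.\<close>
    have extend: "d + card (\<Union>j\<in>insert t \<sigma>. P j) \<le> card \<sigma> + card V" if \<sigma>: "\<sigma> \<subseteq> T" for \<sigma>
    proof -
      let ?W = "\<Union>j\<in>insert t \<sigma>. P j"
      have W: "?W \<subseteq> ?U" using t \<sigma> by blast
      have fin\<sigma>: "finite \<sigma>" using \<sigma> fin finite_subset by blast
      have "\<forall>k\<in>?U - ?W. \<exists>j\<in>T. k \<in> P j" by blast
      then obtain c where c: "\<And>k. k \<in> ?U - ?W \<Longrightarrow> c k \<in> T \<and> k \<in> P (c k)" by metis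
      let ?\<sigma> = "insert t \<sigma> \<union> c ` (?U - ?W)"
      have *: "?\<sigma> \<subseteq> T" using t \<sigma> c by blast
      have "(\<Union>j\<in>?\<sigma>. P j) = ?U"
      proof
        show "(\<Union>j\<in>?\<sigma>. P j) \<subseteq> ?U" using * by blast
        show "?U \<subseteq> (\<Union>j\<in>?\<sigma>. P j)" using c by blast
      qed
      then have "d + 1 + card ?U \<le> card ?\<sigma> + card V" using cover[of ?\<sigma>] * by blast
      also have "card ?\<sigma> \<le> Suc (card \<sigma>) + card (?U - ?W)"
      proof -
        have "card ?\<sigma> \<le> card (insert t \<sigma>) + card (c ` (?U - ?W))" by (rule card_Un_le)
        moreover have "card (insert t \<sigma>) \<le> Suc (card \<sigma>)" using fin\<sigma> by (simp add: card_insert_if)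
        moreover have "card (c ` (?U - ?W)) \<le> card (?U - ?W)" using finU by (intro card_image_le) auto
        ultimately show ?thesis by linarith
      qed
      also have "card (?U - ?W) = card ?U - card ?W"
        using W finU by (intro card_Diff_subset) (auto intro: finite_subset)
      finally have "d + 1 + card ?U \<le> Suc (card \<sigma>) + (card ?U - card ?W) + card V" by simp
      moreover have "card ?W \<le> card ?U" using W finU by (rule card_mono[rotated])
      ultimately show ?thesis by linarith
    qed
    have PtV: "P t \<subseteq> V" using PV t by blast
    have VV: "V = P t \<union> (V - P t)" using PtV by blast
    have cardV: "card (V - P t) + card (P t) = card V"
      using fin(2) PtV finP[OF t] card_mono[OF fin(2) PtV] by (simp add: card_Diff_subset)

    have "cone_partitionable (P t \<union> (V - P t)) (0 + card (V - P t)) (B \<inter> UNIV)"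
      unfolding B_def
      by (intro cone_partitionable_inter cone_partitionable_box cone_partitionable_UNIV)
         (use finP[OF t] fin in auto)
    moreover have "d \<le> card (V - P t)" using extend[of "{}"] cardV by simp
    ultimately have partB: "cone_partitionable V d B"
      using VV cone_partitionable_mono by fastforce

    have part_slice: "cone_partitionable V d (slice \<sigma>)" if \<sigma>\<Sigma>: "\<sigma> \<in> \<Sigma>" for \<sigma>
    proof (cases "P t \<subseteq> (\<Union>j\<in>\<sigma>. P j)")
      case True
      have \<sigma>: "\<sigma> \<subseteq> T - {t}" "\<sigma> \<noteq> {}" using \<sigma>\<Sigma> by (auto simp: \<Sigma>_def)
      have *: "\<forall>k\<in>P t. \<exists>j\<in>\<sigma>. k \<in> P j \<and> a j k \<le> a t k"
        using hyp[OF t _ True] \<sigma> by blast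
      have "A \<sigma> = {}"
      proof (rule ccontr)
        assume "A \<sigma> \<noteq> {}"
        then obtain m k where mk: "m \<in> A \<sigma>" "k \<in> P t" "a t k \<le> m k" by (auto simp: A_def)
        then obtain j where j: "j \<in> \<sigma>" "k \<in> P j" "a j k \<le> a t k" using * by blast
        moreover have "\<forall>k\<in>P j \<inter> P t. m k < a j k" using mk(1) j(1) \<sigma>(1) unfolding A_def by blast
        ultimately have "m k < a j k" using mk(2) by blast
        then show False using j mk by simp
      qed
      then show ?thesis by (simp add: slice_def cone_partitionable_empty)
    next
      case False
      have \<sigma>: "\<sigma> \<subseteq> T - {t}" "\<sigma> \<noteq> {}" using \<sigma>\<Sigma> by (auto simp: \<Sigma>_def)
      then have \<sigma>T: "\<sigma> \<subseteq> T" by blast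
      obtain k where k: "k \<in> P t" "\<And>j. j \<in> \<sigma> \<Longrightarrow> k \<notin> P j" using False by blast
      \<comment> \<open>N bounds every exponent that is compared with a coordinate in
        \<open>P t\<close>, so capping at N leaves these comparisons unchanged.\<close>
      define N where "N = Max (insert 0 ((\<lambda>(j, k). a j k) ` (T \<times> P t)))"
      have N: "a j k \<le> N" if "j \<in> T" "k \<in> P t" for j k
        unfolding N_def using fin finP t that by (intro Max_ge) auto
      have partA: "cone_partitionable (P t) 1 (A \<sigma>)"
      proof (rule cone_partitionable_upward_closed[OF finP[OF t] k(1), where N = N])
        fix m m' assume eq: "\<And>l. l \<in> P t \<Longrightarrow> min (m l) N = min (m' l) N"
        have *: "a j l \<le> m l \<longleftrightarrow> a j l \<le> m' l" if "j \<in> T" "l \<in> P t" for j l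
          using N[OF that] eq[OF that(2)] by (auto simp: min_def split: if_splits)
        have **: "(\<forall>k\<in>P j \<inter> P t. m k < a j k) \<longleftrightarrow> (\<forall>k\<in>P j \<inter> P t. m' k < a j k)"
          if "j \<in> T - {t}" for j
          using * that by (auto simp: not_le[symmetric])
        show "m \<in> A \<sigma> \<longleftrightarrow> m' \<in> A \<sigma>"
          unfolding A_def using * t ** by auto
      next
        \<comment> \<open>Increasing coordinate k does not change \<sigma>: components in \<sigma>
          do not involve k, and a larger exponent cannot establish the strict inequalities of a
          component outside \<sigma>. The witness for t survives as well.\<close>
        fix m x assume m: "m \<in> A \<sigma>" "m k \<le> x"
        have "(\<forall>l\<in>P j \<inter> P t. (m(k := x)) l < a j l)"
          if "\<forall>l\<in>P j \<inter> P t. m l < a j l" "j \<in> \<sigma>" for j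
          using k that by auto
        moreover have "(\<forall>l\<in>P j \<inter> P t. m l < a j l)"
          if "\<forall>l\<in>P j \<inter> P t. (m(k := x)) l < a j l" for j
          using that m(2) by (metis fun_upd_apply le_less_trans)
        moreover have "\<exists>l\<in>P t. a t l \<le> (m(k := x)) l"
        proof -
          obtain l where "l \<in> P t" "a t l \<le> m l" using m by (auto simp: A_def)
          then show ?thesis using m(2) by (intro bexI[of _ l]) auto
        qed
        ultimately show "m(k := x) \<in> A \<sigma>"
          using m(1) unfolding A_def by blast
      qed
      have partO: "cone_partitionable (V - P t) (d - 1) (outside \<sigma> P' a)"
      proof (rule less.hyps)
        show "card \<sigma> < card T" using \<sigma> t fin(1) by (intro psubset_card_mono) auto
        show "finite \<sigma>" using \<sigma>T fin finite_subset by blast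
        show "finite (V - P t)" using fin by blast
        show "P' j \<subseteq> V - P t" if "j \<in> \<sigma>" for j using PV \<sigma>T that by (auto simp: P'_def)
      next
        \<comment> \<open>Adding t covers the part of \<open>P i\<close> inside \<open>P t\<close>.
          The witness found for a variable of \<open>P' i\<close> is still in \<rho>, because that
          variable is not in \<open>P t\<close>.\<close>
        fix i \<rho> assume *: "i \<in> \<sigma>" "\<rho> \<subseteq> \<sigma>" "P' i \<subseteq> (\<Union>j\<in>\<rho>. P' j)"
        then have "P i \<subseteq> (\<Union>j\<in>insert t \<rho>. P j)" by (auto simp: P'_def)
        then have "\<forall>k\<in>P i. \<exists>j\<in>insert t \<rho>. k \<in> P j \<and> a j k \<le> a i k"
          using hyp[of i "insert t \<rho>"] * \<sigma>T t by blast
        then show "\<forall>k\<in>P' i. \<exists>j\<in>\<rho>. k \<in> P' j \<and> a j k \<le> a i k" by (auto simp: P'_def)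
      next
        fix \<rho> assume *: "\<rho> \<subseteq> \<sigma>" "\<rho> \<noteq> {}" "(\<Union>j\<in>\<rho>. P' j) = (\<Union>j\<in>\<sigma>. P' j)"
        let ?U' = "\<Union>j\<in>\<sigma>. P' j"
        have "finite \<rho>" by (rule finite_subset[OF order_trans[OF *(1) \<sigma>T] fin(1)])
        then have \<rho>: "1 \<le> card \<rho>" using *(2) by (simp add: Suc_le_eq card_gt_0_iff)
        have "(\<Union>j\<in>insert t \<rho>. P j) = (\<Union>j\<in>\<rho>. P' j) \<union> P t" by (auto simp: P'_def)
        then have "(\<Union>j\<in>insert t \<rho>. P j) = ?U' \<union> P t" unfolding *(3) .
        moreover have "?U' \<subseteq> ?U" using \<sigma>T by (auto simp: P'_def)
        then have finU': "finite ?U'" by (rule finite_subset[OF _ finU])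
        then have "card (?U' \<union> P t) = card ?U' + card (P t)"
          by (rule card_Un_disjoint) (use finP[OF t] in \<open>auto simp: P'_def\<close>)
        ultimately have "d + card ?U' + card (P t) \<le> card \<rho> + card V"
          using extend[OF order_trans[OF *(1) \<sigma>T]] by simp
        then have "d + card ?U' \<le> card \<rho> + card (V - P t)" using cardV by linarith
        moreover have "card ?U' \<le> card (V - P t)"
          by (rule card_mono) (use fin PV \<sigma>T in \<open>auto simp: P'_def\<close>)
        \<comment> \<open>For d = 0 the truncated d - 1 leaves 1 + card U' on the left; this case
          rests on card \<rho> \<ge> 1 and card U' \<le> card (V - P t).\<close>
        ultimately show "d - 1 + 1 + card ?U' \<le> card \<rho> + card (V - P t)"
          using \<rho> by linarith
      qed
      \<comment> \<open>1 + (d - 1) is d, or 1 when d = 0, so it is at least d in either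
        case.\<close>
      have "cone_partitionable (P t \<union> (V - P t)) (1 + (d - 1)) (slice \<sigma>)"
        unfolding slice_def
        by (rule cone_partitionable_inter[OF partA partO]) (use finP[OF t] fin in auto)
      then show ?thesis using VV cone_partitionable_mono[of V "1 + (d - 1)" _ d] by simp
    qed
    have "disjoint_family_on slice \<Sigma>"
      unfolding disjoint_family_on_def
    proof (intro ballI impI)
      fix \<sigma> \<rho> assume *: "\<sigma> \<in> \<Sigma>" "\<rho> \<in> \<Sigma>" "\<sigma> \<noteq> \<rho>"
      then obtain j where "j \<in> T - {t}" "(j \<in> \<sigma>) \<noteq> (j \<in> \<rho>)" by (auto simp: \<Sigma>_def)
      then show "slice \<sigma> \<inter> slice \<rho> = {}" by (auto simp: slice_def A_def)
    qed
    moreover have "finite \<Sigma>" unfolding \<Sigma>_def by (rule finite_subset[of _ "Pow T"]) (use fin in auto)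
    ultimately have "cone_partitionable V d (\<Union>\<sigma>\<in>\<Sigma>. slice \<sigma>)"
      using part_slice by (intro cone_partitionable_Union)
    moreover have "B \<inter> (\<Union>\<sigma>\<in>\<Sigma>. slice \<sigma>) = {}"
      by (auto simp: B_def slice_def A_def not_le[symmetric])
    moreover have "outside T P a = B \<union> (\<Union>\<sigma>\<in>\<Sigma>. slice \<sigma>)"
    proof (intro equalityI subsetI)
      fix m assume m: "m \<in> outside T P a"
      show "m \<in> B \<union> (\<Union>\<sigma>\<in>\<Sigma>. slice \<sigma>)"
      proof (cases "m \<in> B")
        case False
        define \<sigma> where "\<sigma> = {j \<in> T - {t}. \<forall>k\<in>P j \<inter> P t. m k < a j k}"
        obtain j where j: "j \<in> T" "\<forall>k\<in>P j. m k < a j k" using m by (auto simp: outside_def)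
        have "j \<noteq> t" using j False by (auto simp: B_def)
        then have "j \<in> \<sigma>" using j by (auto simp: \<sigma>_def)
        then have "\<sigma> \<in> \<Sigma>" "m \<in> outside \<sigma> P' a" using j by (auto simp: \<Sigma>_def \<sigma>_def outside_def P'_def)
        moreover have "m \<in> A \<sigma>" using False by (auto simp: A_def \<sigma>_def B_def not_less)
        ultimately show ?thesis by (auto simp: slice_def)
      qed auto
    next
      fix m assume "m \<in> B \<union> (\<Union>\<sigma>\<in>\<Sigma>. slice \<sigma>)"
      then show "m \<in> outside T P a"
      proof
        assume "m \<in> B"
        then show ?thesis using t by (auto simp: B_def outside_def)
      next
        assume "m \<in> (\<Union>\<sigma>\<in>\<Sigma>. slice \<sigma>)"
        then obtain \<sigma> j where *: "\<sigma> \<in> \<Sigma>" "m \<in> A \<sigma>" "j \<in> \<sigma>" "\<forall>k\<in>P j - P t. m k < a j k"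
          by (auto simp: slice_def outside_def P'_def)
        then have "j \<in> T - {t}" by (auto simp: \<Sigma>_def)
        then have "\<forall>k\<in>P j \<inter> P t. m k < a j k" using * by (auto simp: A_def)
        then show ?thesis using * \<open>j \<in> T - {t}\<close> by (auto simp: outside_def)
      qed
    qed
    ultimately show ?thesis using cone_partitionable_Un[OF partB] by simp
  qed
qed

subsection \<open>Monomial ideals\<close>

lemma ring_of_type_algebra_simps [simp]:
  "carrier ring_of_type_algebra = UNIV"
  "x \<otimes>\<^bsub>ring_of_type_algebra\<^esub> y = x * y"
  "x \<oplus>\<^bsub>ring_of_type_algebra\<^esub> y = x + y"
  "\<one>\<^bsub>ring_of_type_algebra\<^esub> = 1"
  "\<zero>\<^bsub>ring_of_type_algebra\<^esub> = 0"
  by (simp_all add: ring_of_type_algebra_def)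

lemma nat_pow_ring_of_type_algebra [simp]:
  fixes x :: "'a::comm_ring_1"
  shows "x [^]\<^bsub>ring_of_type_algebra\<^esub> (k::nat) = x ^ k"
proof -
  interpret cring "ring_of_type_algebra :: 'a ring" by (rule cring_from_type_algebra)
  show ?thesis by (induction k) (simp_all add: mult.commute)
qed

lemma a_inv_ring_of_type_algebra [simp]:
  fixes x :: "'a::comm_ring_1"
  shows "\<ominus>\<^bsub>ring_of_type_algebra\<^esub> x = - x"
proof -
  interpret cring "ring_of_type_algebra :: 'a ring" by (rule cring_from_type_algebra)
  show ?thesis by (rule sum_zero_eq_neg[symmetric]) simp_all
qed

lemma ideal_ring_of_type_algebra_iff:
  fixes I :: "'a::comm_ring_1 set"
  shows "ideal I ring_of_type_algebra \<longleftrightarrow>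
    0 \<in> I \<and> (\<forall>a\<in>I. \<forall>b\<in>I. a + b \<in> I) \<and> (\<forall>a\<in>I. \<forall>r. r * a \<in> I)"
proof
  assume "ideal I ring_of_type_algebra"
  then interpret ideal I "ring_of_type_algebra :: 'a ring" .
  show "0 \<in> I \<and> (\<forall>a\<in>I. \<forall>b\<in>I. a + b \<in> I) \<and> (\<forall>a\<in>I. \<forall>r. r * a \<in> I)"
  proof (intro conjI ballI allI)
    show "0 \<in> I" using additive_subgroup.zero_closed[OF is_additive_subgroup] unfolding ring_of_type_algebra_simps .
    show "a + b \<in> I" if "a \<in> I" "b \<in> I" for a b
      using additive_subgroup.a_closed[OF is_additive_subgroup that] unfolding ring_of_type_algebra_simps .
    show "r * a \<in> I" if "a \<in> I" for a r
      using I_l_closed[OF that, of r] unfolding ring_of_type_algebra_simps by simp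
  qed
next
  assume *: "0 \<in> I \<and> (\<forall>a\<in>I. \<forall>b\<in>I. a + b \<in> I) \<and> (\<forall>a\<in>I. \<forall>r. r * a \<in> I)"
  interpret cring "ring_of_type_algebra :: 'a ring" by (rule cring_from_type_algebra)
  have neg: "- a \<in> I" if "a \<in> I" for a
    using * that by (metis mult_minus1)
  show "ideal I ring_of_type_algebra"
  proof (rule idealI[OF ring_axioms])
    show "subgroup I (add_monoid ring_of_type_algebra)"
      by (rule add.subgroupI) (use * neg in \<open>auto simp flip: a_inv_def\<close>)
  qed (use * in \<open>auto simp: mult.commute\<close>)
qed

lemma sum_mem_ideal:
  fixes I :: "'a::comm_ring_1 set"
  assumes "ideal I ring_of_type_algebra" "\<And>x. x \<in> B \<Longrightarrow> f x \<in> I"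
  shows "sum f B \<in> I"
  using assms(2) by (induction B rule: infinite_finite_induct)
    (use assms(1) in \<open>auto simp: ideal_ring_of_type_algebra_iff\<close>)

lemma ideal_sum_eq_Idl_generators:
  assumes "ring R" "\<And>j. j \<in> J \<Longrightarrow> B j \<subseteq> carrier R"
  shows "ideal_sum R (\<lambda>j. Idl\<^bsub>R\<^esub> (B j)) J = Idl\<^bsub>R\<^esub> (\<Union>j\<in>J. B j)"
proof -
  interpret ring R by fact
  have sub: "(\<Union>j\<in>J. B j) \<subseteq> carrier R" using assms by blast
  have sub2: "(\<Union>j\<in>J. Idl\<^bsub>R\<^esub> (B j)) \<subseteq> carrier R"
    using assms genideal_ideal by (meson UN_least additive_subgroup.a_subset ideal.axioms(1))
  show ?thesis unfolding ideal_sum_def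
  proof (rule antisym)
    show "Idl\<^bsub>R\<^esub> (\<Union>j\<in>J. Idl\<^bsub>R\<^esub> (B j)) \<subseteq> Idl\<^bsub>R\<^esub> (\<Union>j\<in>J. B j)"
      using sub assms by (intro genideal_minimal genideal_ideal UN_least)
        (auto intro!: genideal_self[THEN subsetD])
    have "(\<Union>j\<in>J. B j) \<subseteq> (\<Union>j\<in>J. Idl\<^bsub>R\<^esub> (B j))"
      by (rule UN_mono[OF order_refl]) (rule genideal_self[OF assms(2)])
    also have "\<dots> \<subseteq> Idl\<^bsub>R\<^esub> (\<Union>j\<in>J. Idl\<^bsub>R\<^esub> (B j))"
      by (rule genideal_self[OF sub2])
    finally show "Idl\<^bsub>R\<^esub> (\<Union>j\<in>J. B j) \<subseteq> Idl\<^bsub>R\<^esub> (\<Union>j\<in>J. Idl\<^bsub>R\<^esub> (B j))"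
      by (rule genideal_minimal[OF genideal_ideal[OF sub2]])
  qed
qed

section \<open>Ideals spanned by monomials and by pure powers\<close>

definition monomial_span :: "('n::finite \<Rightarrow>\<^sub>0 nat) set \<Rightarrow> ('n, 'k::field) mpoly set"
  where "monomial_span E = {p. Poly_Mapping.keys p \<subseteq> E}"

lemma poly_mapping_eq_sum_single:
  fixes p :: "'a \<Rightarrow>\<^sub>0 'b::comm_monoid_add"
  shows "p = (\<Sum>m\<in>Poly_Mapping.keys p. Poly_Mapping.single m (Poly_Mapping.lookup p m))"
  by (rule poly_mapping_eqI) (auto simp: lookup_sum lookup_single when_def in_keys_iff)

lemma monomial_span_ideal:
  assumes "\<And>m w. m \<in> E \<Longrightarrow> m + w \<in> E"
  shows "ideal (monomial_span E) \<S>"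
proof -
  have "Poly_Mapping.keys (r * p) \<subseteq> E" if "Poly_Mapping.keys p \<subseteq> E" for r p :: "('a, 'b) mpoly"
    using keys_mult[of r p] that assms by (force simp: add.commute)
  moreover have "Poly_Mapping.keys (p + q) \<subseteq> E"
    if "Poly_Mapping.keys p \<subseteq> E" "Poly_Mapping.keys q \<subseteq> E" for p q :: "('a, 'b) mpoly"
    using Poly_Mapping.keys_add[of p q] that by blast
  ultimately show ?thesis
    by (simp add: ideal_ring_of_type_algebra_iff monomial_span_def)
qed

text \<open>Membership is decided term by term, since each term of an element of the span is a
  multiple of a generator. This is what allows monomial ideals to be handled through exponent
  sets.\<close>

lemma Idl_monomials:
  "Idl\<^bsub>\<S>\<^esub> (monomial ` A) = (monomial_span {m. \<exists>u\<in>A. \<exists>w. m = u + w} :: ('n::finite, 'k::field) mpoly set)"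
proof -
  interpret cring "\<S> :: ('n, 'k) mpoly ring" by (rule cring_from_type_algebra)
  let ?E = "{m. \<exists>u\<in>A. \<exists>w. m = u + w}"
  have I: "ideal (Idl\<^bsub>\<S>\<^esub> (monomial ` A :: ('n, 'k) mpoly set)) \<S>" by (rule genideal_ideal) simp
  have "ideal (monomial_span ?E :: ('n, 'k) mpoly set) \<S>"
    by (rule monomial_span_ideal) (auto, metis add.assoc)
  moreover have "monomial ` A \<subseteq> (monomial_span ?E :: ('n, 'k) mpoly set)"
    unfolding monomial_span_def monomial_def by auto (metis add.right_neutral)
  ultimately have 1: "Idl\<^bsub>\<S>\<^esub> (monomial ` A) \<subseteq> (monomial_span ?E :: ('n, 'k) mpoly set)"
    by (rule genideal_minimal)
  have "p \<in> Idl\<^bsub>\<S>\<^esub> (monomial ` A)" if p: "p \<in> monomial_span ?E" for p :: "('n, 'k) mpoly"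
  proof -
    have "Poly_Mapping.single m (Poly_Mapping.lookup p m) \<in> Idl\<^bsub>\<S>\<^esub> (monomial ` A)"
      if "m \<in> Poly_Mapping.keys p" for m
    proof -
      obtain u w where u: "u \<in> A" "m = u + w"
        using p \<open>m \<in> Poly_Mapping.keys p\<close> unfolding monomial_span_def by blast
      have "monomial u \<in> Idl\<^bsub>\<S>\<^esub> (monomial ` A :: ('n, 'k) mpoly set)"
        using u(1) genideal_self[of "monomial ` A"] by auto
      then have "Poly_Mapping.single w (Poly_Mapping.lookup p m) * monomial u \<in> Idl\<^bsub>\<S>\<^esub> (monomial ` A)"
        using I unfolding ideal_ring_of_type_algebra_iff by blast
      then show ?thesis by (simp add: monomial_def mult_single u(2) add.commute)
    qed
    then show ?thesis
      by (subst poly_mapping_eq_sum_single) (rule sum_mem_ideal[OF I])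
  qed
  then show ?thesis using 1 by blast
qed

definition divisible :: "('n::finite \<times> nat) set \<Rightarrow> ('n \<Rightarrow>\<^sub>0 nat) set"
  where "divisible G = {m. \<exists>i a. (i, a) \<in> G \<and> a \<le> Poly_Mapping.lookup m i}"

lemma divisible_variables_iff: "m \<in> divisible (U \<times> {1}) \<longleftrightarrow> (\<exists>i\<in>U. Poly_Mapping.lookup m i \<noteq> 0)"
  by (auto simp: divisible_def Suc_le_eq)

text \<open>G may list several powers of one variable, as the definition of an irreducible monomial
  ideal permits. The case \<open>U \<times> {1}\<close> is the monomial prime generated by the
  variables in U.\<close>

abbreviation power_ideal :: "('n::finite \<times> nat) set \<Rightarrow> ('n, 'k::field) mpoly set"
  where "power_ideal G \<equiv> monomial_span (divisible G)"

lemma Idl_var_powers: "Idl\<^bsub>\<S>\<^esub> ((\<lambda>(i, a). var_power i a) ` G) = power_ideal G"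
proof -
  have "(\<exists>w. m = Poly_Mapping.single i a + w) \<longleftrightarrow> a \<le> Poly_Mapping.lookup m i"
    for m :: "'a \<Rightarrow>\<^sub>0 nat" and i a
  proof
    assume "a \<le> Poly_Mapping.lookup m i"
    then have "m = Poly_Mapping.single i a + (m - Poly_Mapping.single i a)"
      by (intro poly_mapping_eqI) (auto simp: lookup_add lookup_minus lookup_single when_def)
    then show "\<exists>w. m = Poly_Mapping.single i a + w" by blast
  qed (auto simp: lookup_add)
  then have "{m. \<exists>u\<in>(\<lambda>(i, a). Poly_Mapping.single i a) ` G. \<exists>w. m = u + w} = divisible G"
    unfolding divisible_def by fastforce
  moreover have *: "(\<lambda>(i, a). var_power i a) ` G = monomial ` (\<lambda>(i, a). Poly_Mapping.single i a) ` G"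
    by (auto simp: var_power_def image_image case_prod_beta)
  ultimately show ?thesis unfolding * Idl_monomials by simp
qed

lemma divisible_add: "m \<in> divisible G \<Longrightarrow> m + w \<in> divisible G"
  by (fastforce simp: divisible_def lookup_add intro: trans_le_add1)

lemma power_ideal_ideal: "ideal (power_ideal G) \<S>"
  by (rule monomial_span_ideal) (rule divisible_add)

lemma ideal_sum_power_ideals:
  "ideal_sum \<S> (\<lambda>j. power_ideal (G j)) J = (power_ideal (\<Union>j\<in>J. G j) :: ('n::finite, 'k::field) mpoly set)"
proof -
  let ?f = "\<lambda>(i, a). var_power i a :: ('n, 'k) mpoly"
  have "ideal_sum \<S> (\<lambda>j. Idl\<^bsub>\<S>\<^esub> (?f ` G j)) J = Idl\<^bsub>\<S>\<^esub> (\<Union>j\<in>J. ?f ` G j)"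
    by (rule ideal_sum_eq_Idl_generators[OF ring_from_type_algebra]) simp
  then show ?thesis by (simp only: Idl_var_powers image_UN[symmetric])
qed

lemma ideal_sum_cong: "(\<And>j. j \<in> J \<Longrightarrow> Q j = Q' j) \<Longrightarrow> ideal_sum R Q J = ideal_sum R Q' J"
  unfolding ideal_sum_def by simp

lemma irreducible_monomial_ideal_iff:
  "irreducible_monomial_ideal I \<longleftrightarrow> (\<exists>G. (\<forall>(i, a)\<in>G. 1 \<le> a) \<and> I = power_ideal G)"
  unfolding irreducible_monomial_ideal_def Idl_var_powers ..

lemma monomial_ideal_power_ideal: "monomial_ideal (power_ideal G)"
proof -
  have "power_ideal G = Idl\<^bsub>\<S>\<^esub> (monomial ` (\<lambda>(i, a). Poly_Mapping.single i a) ` G)"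
    unfolding Idl_var_powers[symmetric] by (simp add: var_power_def image_image case_prod_beta)
  then show ?thesis unfolding monomial_ideal_def by blast
qed

text \<open>Excludes cancellation: over a field, a coefficient of a product to which only one pair
  of terms contributes is nonzero.\<close>

lemma lookup_mult_unique:
  fixes f g :: "'a::monoid_add \<Rightarrow>\<^sub>0 'b::semiring_0"
  assumes "m \<in> Poly_Mapping.keys f" "n \<in> Poly_Mapping.keys g"
    and uniq: "\<And>u v. u \<in> Poly_Mapping.keys f \<Longrightarrow> v \<in> Poly_Mapping.keys g \<Longrightarrow> u + v = m + n \<Longrightarrow> u = m \<and> v = n"
  shows "Poly_Mapping.lookup (f * g) (m + n) = Poly_Mapping.lookup f m * Poly_Mapping.lookup g n"
proof -
  have "f * g = (\<Sum>u\<in>Poly_Mapping.keys f. Poly_Mapping.single u (Poly_Mapping.lookup f u)) *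
      (\<Sum>v\<in>Poly_Mapping.keys g. Poly_Mapping.single v (Poly_Mapping.lookup g v))"
    using poly_mapping_eq_sum_single[of f] poly_mapping_eq_sum_single[of g] by simp
  also have "\<dots> = (\<Sum>(u, v)\<in>Poly_Mapping.keys f \<times> Poly_Mapping.keys g.
      Poly_Mapping.single (u + v) (Poly_Mapping.lookup f u * Poly_Mapping.lookup g v))"
    by (simp add: sum_product mult_single sum.cartesian_product)
  finally have "Poly_Mapping.lookup (f * g) (m + n) = (\<Sum>(u, v)\<in>Poly_Mapping.keys f \<times> Poly_Mapping.keys g.
      Poly_Mapping.lookup f u * Poly_Mapping.lookup g v when u + v = m + n)"
    by (simp add: lookup_sum lookup_single case_prod_beta)
  also have "\<dots> = (\<Sum>(u, v)\<in>{(m, n)}. Poly_Mapping.lookup f u * Poly_Mapping.lookup g v when u + v = m + n)"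
    by (rule sum.mono_neutral_right) (use assms(1,2) in \<open>auto simp: when_def split: if_splits dest: uniq\<close>)
  finally show ?thesis by simp
qed

text \<open>A substitute for a monomial order on the finitely many monomials in play: exponents are
  read as digits in a mixed radix, one variable after the other.\<close>

lemma exists_injective_additive_weight:
  fixes F :: "('n::finite \<Rightarrow>\<^sub>0 nat) set"
  assumes "finite F"
  shows "\<exists>w :: ('n \<Rightarrow>\<^sub>0 nat) \<Rightarrow> nat. (\<forall>x y. w (x + y) = w x + w y) \<and> inj_on w F"
proof -
  have "\<exists>w :: ('n \<Rightarrow>\<^sub>0 nat) \<Rightarrow> nat. (\<forall>x y. w (x + y) = w x + w y) \<and>
      (\<forall>x\<in>F. \<forall>y\<in>F. w x = w y \<longrightarrow> (\<forall>i\<in>V. Poly_Mapping.lookup x i = Poly_Mapping.lookup y i))" for V :: "'n set"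
    using finite[of V]
  proof (induction V)
    case empty
    show ?case by (rule exI[of _ "\<lambda>_. 0"]) simp
  next
    case (insert i V)
    then obtain w :: "('n \<Rightarrow>\<^sub>0 nat) \<Rightarrow> nat" where w: "\<And>x y. w (x + y) = w x + w y"
      "\<And>x y i. x \<in> F \<Longrightarrow> y \<in> F \<Longrightarrow> w x = w y \<Longrightarrow> i \<in> V \<Longrightarrow> Poly_Mapping.lookup x i = Poly_Mapping.lookup y i"
      by blast
    \<comment> \<open>N exceeds every i-th exponent in F, so the old weight and the i-th exponent
      are quotient and remainder of the new weight under division by N.\<close>
    define N where "N = Suc (Max (insert 0 ((\<lambda>x. Poly_Mapping.lookup x i) ` F)))"
    have N: "Poly_Mapping.lookup x i < N" if "x \<in> F" for x
      unfolding N_def using assms that by (intro le_imp_less_Suc Max_ge) auto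
    let ?w = "\<lambda>x. N * w x + Poly_Mapping.lookup x i"
    have inj: "w x = w y \<and> Poly_Mapping.lookup x i = Poly_Mapping.lookup y i"
      if "x \<in> F" "y \<in> F" "?w x = ?w y" for x y
    proof -
      have *: "?w z mod N = Poly_Mapping.lookup z i" "?w z div N = w z" if "z \<in> F" for z
        using N[OF that] by auto
      show ?thesis using *[OF that(1)] *[OF that(2)] that(3) by simp
    qed
    show ?case
    proof (intro exI[of _ ?w] conjI allI ballI impI)
      show "?w (x + y) = ?w x + ?w y" for x y by (simp add: w(1) lookup_add algebra_simps)
      show "Poly_Mapping.lookup x l = Poly_Mapping.lookup y l"
        if "x \<in> F" "y \<in> F" "?w x = ?w y" "l \<in> insert i V" for x y l
        using inj[OF that(1-3)] w(2)[OF that(1,2)] that(4) by blast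
    qed
  qed
  from this[of UNIV] obtain w :: "('n \<Rightarrow>\<^sub>0 nat) \<Rightarrow> nat" where w: "\<And>x y. w (x + y) = w x + w y"
    "\<And>x y i. x \<in> F \<Longrightarrow> y \<in> F \<Longrightarrow> w x = w y \<Longrightarrow> Poly_Mapping.lookup x i = Poly_Mapping.lookup y i"
    by blast
  have "inj_on w F" by (intro inj_onI poly_mapping_eqI w(2))
  with w(1) show ?thesis by auto
qed

definition restrict_poly :: "'a set \<Rightarrow> ('a \<Rightarrow>\<^sub>0 'b::zero) \<Rightarrow> 'a \<Rightarrow>\<^sub>0 'b"
  where "restrict_poly E p = Poly_Mapping.mapp (\<lambda>m c. c when m \<in> E) p"

lemma lookup_restrict_poly: "Poly_Mapping.lookup (restrict_poly E p) m = (Poly_Mapping.lookup p m when m \<in> E)"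
  unfolding restrict_poly_def lookup_mapp by (simp add: when_def in_keys_iff)

lemma keys_restrict_poly: "Poly_Mapping.keys (restrict_poly E p) = Poly_Mapping.keys p \<inter> E"
  by (auto simp: in_keys_iff lookup_restrict_poly)

lemma exists_lex_least:
  fixes f g :: "'a \<Rightarrow> nat"
  assumes "F \<noteq> {}"
  shows "\<exists>m\<in>F. \<forall>u\<in>F. f m \<le> f u \<and> (f u = f m \<longrightarrow> g m \<le> g u)"
proof -
  obtain z where "z \<in> F" "\<And>y. (y, z) \<in> measures [f, g] \<Longrightarrow> y \<notin> F"
    using wfE_min'[OF wf_measures assms] by metis
  then show ?thesis by (intro bexI[of _ z]) (auto simp: not_less[symmetric])
qed

text \<open>
  After discarding the terms of \<open>a\<close> in the ideal, take terms of \<open>a\<close> and \<open>b\<close> of least degree in the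
  variables of \<open>G\<close>, and among those the ones of least weight for an injective additive weight: the
  product of these two terms cannot cancel.
\<close>
lemma power_ideal_mult:
  fixes a b :: "('n::finite, 'k::field) mpoly"
  assumes ab: "a * b \<in> power_ideal G" and a: "a \<notin> power_ideal G"
  shows "b \<in> power_ideal (fst ` G \<times> {1})"
proof (rule ccontr)
  assume b: "b \<notin> power_ideal (fst ` G \<times> {1})"
  define deg where "deg m = (\<Sum>i\<in>fst ` G. Poly_Mapping.lookup m i)" for m :: "'n \<Rightarrow>\<^sub>0 nat"
  have deg_add: "deg (x + y) = deg x + deg y" for x y
    unfolding deg_def by (simp add: lookup_add sum.distrib)
  define c where "c = restrict_poly (- divisible G) a"
  have keys_c: "Poly_Mapping.keys c = Poly_Mapping.keys a - divisible G"
    unfolding c_def keys_restrict_poly by blast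
  have "a - c \<in> power_ideal G"
    unfolding monomial_span_def c_def by (auto simp: in_keys_iff lookup_minus lookup_restrict_poly when_def split: if_splits)
  then have "b * (a - c) \<in> power_ideal G"
    using power_ideal_ideal unfolding ideal_ring_of_type_algebra_iff by blast
  then have "(- 1) * (b * (a - c)) \<in> power_ideal G"
    using power_ideal_ideal unfolding ideal_ring_of_type_algebra_iff by blast
  then have "a * b + (- 1) * (b * (a - c)) \<in> power_ideal G"
    using ab power_ideal_ideal unfolding ideal_ring_of_type_algebra_iff by blast
  then have cb: "c * b \<in> power_ideal G" by (simp add: algebra_simps)
  have c_ne: "Poly_Mapping.keys c \<noteq> {}" using a keys_c unfolding monomial_span_def by auto
  \<comment> \<open>b has a term free of the variables of G, so its least-degree term n has degree 0
    in them. Hence m + n can be in \<open>divisible G\<close> only if m is.\<close>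
  obtain n0 where "n0 \<in> Poly_Mapping.keys b" "n0 \<notin> divisible (fst ` G \<times> {1})"
    using b unfolding monomial_span_def by auto
  then have n0: "n0 \<in> Poly_Mapping.keys b" "deg n0 = 0"
    unfolding divisible_variables_iff deg_def by (auto intro: sum.neutral)
  obtain w :: "('n \<Rightarrow>\<^sub>0 nat) \<Rightarrow> nat" where w: "\<And>x y. w (x + y) = w x + w y"
    and inj: "inj_on w (Poly_Mapping.keys c \<union> Poly_Mapping.keys b)"
    using exists_injective_additive_weight[of "Poly_Mapping.keys c \<union> Poly_Mapping.keys b"]
    by (metis finite_UnI finite_keys)
  have least: "\<exists>m\<in>F. \<forall>u\<in>F. deg m \<le> deg u \<and> (deg u = deg m \<longrightarrow> w m \<le> w u)"
    if F: "F \<noteq> {}" for F :: "('n \<Rightarrow>\<^sub>0 nat) set"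
    using F by (rule exists_lex_least)
  obtain m where m: "m \<in> Poly_Mapping.keys c"
    "\<And>u. u \<in> Poly_Mapping.keys c \<Longrightarrow> deg m \<le> deg u \<and> (deg u = deg m \<longrightarrow> w m \<le> w u)"
    using least[OF c_ne] by blast
  obtain n where n: "n \<in> Poly_Mapping.keys b"
    "\<And>u. u \<in> Poly_Mapping.keys b \<Longrightarrow> deg n \<le> deg u \<and> (deg u = deg n \<longrightarrow> w n \<le> w u)"
    using least[of "Poly_Mapping.keys b"] n0 by blast
  have deg_n: "deg n = 0" using n(2)[OF n0(1)] n0(2) by simp
  have "u = m \<and> v = n" if uv: "u \<in> Poly_Mapping.keys c" "v \<in> Poly_Mapping.keys b" "u + v = m + n" for u v
  proof -
    \<comment> \<open>Minimality bounds both summands from below, so equal sums force equal degrees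
      and then equal weights; injectivity of w finishes.\<close>
    have "deg u + deg v = deg m + deg n" "w u + w v = w m + w n"
      using uv(3) deg_add w by metis+
    then have "w u = w m \<and> w v = w n" using m(2)[OF uv(1)] n(2)[OF uv(2)] by linarith
    then show ?thesis using inj uv m(1) n(1) by (auto dest: inj_onD)
  qed
  then have "Poly_Mapping.lookup (c * b) (m + n) = Poly_Mapping.lookup c m * Poly_Mapping.lookup b n"
    by (rule lookup_mult_unique[OF m(1) n(1)])
  then have "m + n \<in> Poly_Mapping.keys (c * b)" using m(1) n(1) by (simp add: in_keys_iff)
  then have "m + n \<in> divisible G" using cb unfolding monomial_span_def by blast
  then obtain i e where i: "(i, e) \<in> G" "e \<le> Poly_Mapping.lookup m i + Poly_Mapping.lookup n i"
    unfolding divisible_def by (auto simp: lookup_add)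
  moreover have "Poly_Mapping.lookup n i = 0"
    using deg_n i(1) unfolding deg_def by force
  ultimately have "m \<in> divisible G" unfolding divisible_def by auto
  then show False using m(1) keys_c by blast
qed

lemma one_notin_power_ideal: "\<forall>(i, a)\<in>G. 1 \<le> a \<Longrightarrow> 1 \<notin> power_ideal G"
  unfolding monomial_span_def divisible_def by fastforce

text \<open>When all exponents are 1, the ideal in the conclusion of \<open>power_ideal_mult\<close>
  is the given ideal, and that lemma becomes primality.\<close>

lemma primeideal_variables: "primeideal (power_ideal (U \<times> {1})) \<S>"
proof (rule primeidealI)
  show "carrier \<S> \<noteq> (power_ideal (U \<times> {1}) :: ('a, 'b) mpoly set)"
    using one_notin_power_ideal[of "U \<times> {1::nat}"] by auto
next
  fix a b :: "('a, 'b) mpoly"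
  assume *: "a \<otimes>\<^bsub>\<S>\<^esub> b \<in> power_ideal (U \<times> {1})"
  have "fst ` (U \<times> {1::nat}) = U" by auto
  then show "a \<in> power_ideal (U \<times> {1}) \<or> b \<in> power_ideal (U \<times> {1})"
    using power_ideal_mult[of a b "U \<times> {1}"] * by auto
qed (auto intro: power_ideal_ideal cring_from_type_algebra)

lemma radical_subset_prime:
  fixes P :: "'a::comm_ring_1 set"
  assumes P: "primeideal P ring_of_type_algebra" and J: "J \<subseteq> P"
  shows "ideal_radical ring_of_type_algebra J \<subseteq> P"
proof
  fix p assume "p \<in> ideal_radical ring_of_type_algebra J"
  then obtain k :: nat where "p ^ k \<in> P" using J by (auto simp: ideal_radical_def)
  moreover have "p ^ k \<in> P \<Longrightarrow> p \<in> P" for k :: nat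
  proof (induction k)
    case 0
    then have "P = UNIV"
      using ideal.one_imp_carrier[OF primeideal.axioms(1)[OF P]] by simp
    then show ?case by simp
  next
    case (Suc k)
    then show ?case using primeideal.I_prime[OF P, of p "p ^ k"] by auto
  qed
  ultimately show "p \<in> P" by blast
qed

text \<open>One inclusion is primality of the right-hand side. The other is a pigeonhole argument:
  every term of p has degree at least 1 in the variables of G, so every term of \<open>p ^ N\<close>
  has degree at least N, which exceeds the sum of the exponents \<open>c i\<close>; some variable
  must reach its exponent.\<close>

lemma radical_power_ideal:
  assumes G: "\<forall>(i, a)\<in>G. 1 \<le> a"
  shows "ideal_radical \<S> (power_ideal G) = (power_ideal (fst ` G \<times> {1}) :: ('n::finite, 'k::field) mpoly set)"
proof
  have "divisible G \<subseteq> divisible (fst ` G \<times> {1})"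
    using G unfolding divisible_def by force
  then show "ideal_radical \<S> (power_ideal G) \<subseteq> (power_ideal (fst ` G \<times> {1}) :: ('n, 'k) mpoly set)"
    by (intro radical_subset_prime primeideal_variables) (auto simp: monomial_span_def)
next
  define deg where "deg m = (\<Sum>i\<in>fst ` G. Poly_Mapping.lookup m i)" for m :: "'n \<Rightarrow>\<^sub>0 nat"
  have deg_add: "deg (x + y) = deg x + deg y" for x y
    unfolding deg_def by (simp add: lookup_add sum.distrib)
  have "\<forall>i\<in>fst ` G. \<exists>a. (i, a) \<in> G" by auto
  then obtain c where c: "\<And>i. i \<in> fst ` G \<Longrightarrow> (i, c i) \<in> G" by metis
  define N where "N = Suc (\<Sum>i\<in>fst ` G. c i)"
  show "power_ideal (fst ` G \<times> {1}) \<subseteq> (ideal_radical \<S> (power_ideal G) :: ('n, 'k) mpoly set)"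
  proof
    fix p :: "('n, 'k) mpoly" assume p: "p \<in> power_ideal (fst ` G \<times> {1})"
    have deg1: "1 \<le> deg m" if m: "m \<in> Poly_Mapping.keys p" for m
    proof -
      have "m \<in> divisible (fst ` G \<times> {1})" using p m unfolding monomial_span_def by blast
      then obtain i where i: "i \<in> fst ` G" "1 \<le> Poly_Mapping.lookup m i"
        unfolding divisible_variables_iff by (auto simp: Suc_le_eq)
      have "Poly_Mapping.lookup m i \<le> deg m"
        unfolding deg_def by (rule member_le_sum) (use i in auto)
      then show ?thesis using i by simp
    qed
    have degk: "k \<le> deg m" if "m \<in> Poly_Mapping.keys (p ^ k)" for k m
      using that
    proof (induction k arbitrary: m)
      case (Suc k)
      then obtain u v where "u \<in> Poly_Mapping.keys p" "v \<in> Poly_Mapping.keys (p ^ k)" "m = u + v"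
        using keys_mult[of p "p ^ k"] by auto
      then show ?case using deg1[of u] Suc.IH[of v] deg_add[of u v] by simp
    qed simp
    have "m \<in> divisible G" if m: "m \<in> Poly_Mapping.keys (p ^ N)" for m
    proof (rule ccontr)
      assume "m \<notin> divisible G"
      then have "Poly_Mapping.lookup m i \<le> c i" if "i \<in> fst ` G" for i
        using c[OF that] unfolding divisible_def by force
      then have "deg m \<le> (\<Sum>i\<in>fst ` G. c i)" unfolding deg_def by (rule sum_mono)
      then show False using degk[OF m] unfolding N_def by simp
    qed
    then have "p ^ N \<in> power_ideal G" unfolding monomial_span_def by blast
    then show "p \<in> ideal_radical \<S> (power_ideal G)" unfolding ideal_radical_def by auto
  qed
qed

lemma primary_power_ideal:
  assumes G: "\<forall>(i, a)\<in>G. 1 \<le> a"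
  shows "primary_ideal \<S> (power_ideal G :: ('n::finite, 'k::field) mpoly set)"
  using power_ideal_ideal one_notin_power_ideal[OF G] power_ideal_mult
  unfolding primary_ideal_def radical_power_ideal[OF G] by auto

section \<open>Lower bounds for heights\<close>

lemma power_ideal_variables_less:
  assumes "i \<notin> U"
  shows "power_ideal (U \<times> {1}) \<subset> (power_ideal (insert i U \<times> {1}) :: ('n::finite, 'k::field) mpoly set)"
proof -
  let ?x = "Poly_Mapping.single i (1::nat)"
  have "divisible (U \<times> {1}) \<subseteq> divisible (insert i U \<times> {1})"
    by (rule subsetI) (unfold divisible_variables_iff, blast)
  moreover have "?x \<in> divisible (insert i U \<times> {1})" "?x \<notin> divisible (U \<times> {1})"
    unfolding divisible_variables_iff using assms by (auto simp: lookup_single when_def)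
  then have "(monomial ?x :: ('n, 'k) mpoly) \<in> power_ideal (insert i U \<times> {1})"
    "(monomial ?x :: ('n, 'k) mpoly) \<notin> power_ideal (U \<times> {1})"
    unfolding monomial_span_def monomial_def by simp_all
  ultimately show ?thesis unfolding monomial_span_def by blast
qed

text \<open>Adjoining the variables of U one at a time gives a chain of primes inside P with card U
  strict steps.\<close>

lemma prime_height_ge:
  fixes P :: "('n::finite, 'k::field) mpoly set"
  assumes P: "primeideal P \<S>" and U: "power_ideal (U \<times> {1}) \<subseteq> P"
  shows "enat (card U) \<le> prime_height \<S> P"
proof -
  obtain f where f: "bij_betw f {..<card U} U"
    using bij_betw_from_nat_into_finite[OF finite] by blast
  define C :: "nat \<Rightarrow> ('n, 'k) mpoly set" where "C k = power_ideal (f ` {..<k} \<times> {1})" for k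
  have prime: "primeideal (C k) \<S>" for k unfolding C_def by (rule primeideal_variables)
  have less: "C k \<subset> C (Suc k)" if "k < card U" for k
  proof -
    have "f k \<notin> f ` {..<k}" using f that unfolding bij_betw_def inj_on_def by fastforce
    then show ?thesis
      unfolding C_def lessThan_Suc image_insert by (rule power_ideal_variables_less)
  qed
  have last: "C (card U) = power_ideal (U \<times> {1})"
    using f unfolding C_def bij_betw_def by simp
  have *: "enat k \<le> prime_height \<S> P"
    if "\<And>i. i \<le> k \<Longrightarrow> primeideal (C i) \<S>" "\<And>i. i < k \<Longrightarrow> C i \<subset> C (Suc i)" "C k = P"
    for k and C :: "nat \<Rightarrow> ('n, 'k) mpoly set"
    unfolding prime_height_def using that by (intro SUP_upper) blast
  show ?thesis
  proof (cases "C (card U) = P")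
    case True
    then show ?thesis using * prime less by blast
  next
    case False
    \<comment> \<open>If the chain stops short of P, then P is one more link, and the bound improves
      by 1.\<close>
    let ?C = "C(Suc (card U) := P)"
    have "enat (Suc (card U)) \<le> prime_height \<S> P"
    proof (rule *[of _ ?C])
      show "primeideal (?C i) \<S>" if "i \<le> Suc (card U)" for i using prime P by simp
      show "?C i \<subset> ?C (Suc i)" if "i < Suc (card U)" for i
        using that less[of i] False U last by (cases "i = card U") auto
    qed simp
    then show ?thesis by (meson enat_ord_simps(1) le_SucI order_trans order_refl)
  qed
qed

text \<open>A prime over the ideal contains its radical, hence all variables occurring in G.\<close>

lemma height_ge:
  assumes "\<forall>(i, a)\<in>G. 1 \<le> a"
  shows "enat (card (fst ` G)) \<le> height \<S> (power_ideal G :: ('n::finite, 'k::field) mpoly set)"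
  unfolding height_def
  using radical_subset_prime radical_power_ideal[OF assms]
  by (intro INF_greatest prime_height_ge) blast+

subsection \<open>Radicals of primary components and size\<close>

abbreviation rad :: "'a::comm_ring_1 set \<Rightarrow> 'a set"
  where "rad \<equiv> ideal_radical ring_of_type_algebra"

lemma radical_iff: "a \<in> rad I \<longleftrightarrow> (\<exists>k. a ^ k \<in> I)"
  by (simp add: ideal_radical_def)

lemma radical_mono: "I \<subseteq> J \<Longrightarrow> rad I \<subseteq> rad J"
  unfolding radical_iff subset_iff by blast

lemma subset_radical: "I \<subseteq> rad I"
  unfolding radical_iff subset_iff by (metis power_one_right)

lemma power_mem_radicalD: "a ^ k \<in> rad I \<Longrightarrow> a \<in> rad I"
  unfolding radical_iff by (metis power_mult)

lemma radical_radical: "rad (rad I) \<subseteq> rad I"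
  unfolding radical_iff subset_iff by (metis power_mult)

lemma ideal_mult_left: "ideal I ring_of_type_algebra \<Longrightarrow> a \<in> I \<Longrightarrow> r * a \<in> I"
  for I :: "'a::comm_ring_1 set"
  by (simp add: ideal_ring_of_type_algebra_iff)

lemma radical_ideal:
  fixes I :: "'a::comm_ring_1 set"
  assumes I: "ideal I ring_of_type_algebra"
  shows "ideal (rad I) ring_of_type_algebra"
  unfolding ideal_ring_of_type_algebra_iff
proof (intro conjI ballI allI)
  have "0 \<in> I" using I by (simp add: ideal_ring_of_type_algebra_iff)
  then show "0 \<in> rad I" using subset_radical by blast
next
  fix a b assume "a \<in> rad I" "b \<in> rad I"
  then obtain m n where mn: "a ^ m \<in> I" "b ^ n \<in> I" unfolding radical_iff by blast
  have "of_nat (m + n choose k) * a ^ k * b ^ (m + n - k) \<in> I" for k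
  proof (cases "m \<le> k")
    case True
    then have "a ^ k = a ^ (k - m) * a ^ m" by (simp flip: power_add)
    then have "of_nat (m + n choose k) * a ^ k * b ^ (m + n - k) =
        (of_nat (m + n choose k) * a ^ (k - m) * b ^ (m + n - k)) * a ^ m" by (simp add: ac_simps)
    then show ?thesis using ideal_mult_left[OF I mn(1)] by simp
  next
    case False
    then have "b ^ (m + n - k) = b ^ (m - k) * b ^ n" by (simp flip: power_add)
    then have "of_nat (m + n choose k) * a ^ k * b ^ (m + n - k) =
        (of_nat (m + n choose k) * a ^ k * b ^ (m - k)) * b ^ n" by (simp add: ac_simps)
    then show ?thesis using ideal_mult_left[OF I mn(2)] by simp
  qed
  then have "(a + b) ^ (m + n) \<in> I"
    unfolding binomial_ring by (intro sum_mem_ideal[OF I])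
  then show "a + b \<in> rad I" unfolding radical_iff by blast
next
  fix a r assume "a \<in> rad I"
  then obtain k where "a ^ k \<in> I" unfolding radical_iff by blast
  then have "(r * a) ^ k \<in> I" using ideal_mult_left[OF I] by (simp add: power_mult_distrib)
  then show "r * a \<in> rad I" unfolding radical_iff by blast
qed

lemma ideal_sum_least:
  fixes K :: "'a::comm_ring_1 set"
  assumes "ideal K ring_of_type_algebra" "\<And>j. j \<in> J \<Longrightarrow> Q j \<subseteq> K"
  shows "ideal_sum ring_of_type_algebra Q J \<subseteq> K"
  unfolding ideal_sum_def
  by (rule ring.genideal_minimal[OF ring_from_type_algebra assms(1)]) (use assms(2) in blast)

lemma ideal_sum_ideal: "ideal (ideal_sum ring_of_type_algebra Q J) ring_of_type_algebra"
  for Q :: "'i \<Rightarrow> 'a::comm_ring_1 set"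
  unfolding ideal_sum_def by (rule ring.genideal_ideal[OF ring_from_type_algebra]) simp

lemma ideal_sum_upper: "j \<in> J \<Longrightarrow> Q j \<subseteq> ideal_sum ring_of_type_algebra Q J"
  for Q :: "'i \<Rightarrow> 'a::comm_ring_1 set"
proof -
  assume "j \<in> J"
  moreover have "(\<Union>j\<in>J. Q j) \<subseteq> ideal_sum ring_of_type_algebra Q J"
    unfolding ideal_sum_def by (rule ring.genideal_self[OF ring_from_type_algebra]) simp
  ultimately show ?thesis by blast
qed

text \<open>Lets the components in \<open>size_v\<close> be replaced by their radicals; each
  \<open>rad (Q j)\<close> already lies in the radical of the sum.\<close>

lemma radical_ideal_sum:
  fixes Q :: "'i \<Rightarrow> 'a::comm_ring_1 set"
  shows "rad (ideal_sum ring_of_type_algebra Q J) =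
    rad (ideal_sum ring_of_type_algebra (\<lambda>j. rad (Q j)) J)"
proof
  have "Q j \<subseteq> ideal_sum ring_of_type_algebra (\<lambda>j. rad (Q j)) J" if "j \<in> J" for j
    using ideal_sum_upper[OF that, of "\<lambda>j. rad (Q j)"] subset_radical[of "Q j"] by blast
  then show "rad (ideal_sum ring_of_type_algebra Q J) \<subseteq>
      rad (ideal_sum ring_of_type_algebra (\<lambda>j. rad (Q j)) J)"
    by (intro radical_mono ideal_sum_least ideal_sum_ideal)
  have "ideal_sum ring_of_type_algebra (\<lambda>j. rad (Q j)) J \<subseteq> rad (ideal_sum ring_of_type_algebra Q J)"
    by (intro ideal_sum_least radical_ideal ideal_sum_ideal radical_mono ideal_sum_upper)
  then show "rad (ideal_sum ring_of_type_algebra (\<lambda>j. rad (Q j)) J) \<subseteq>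
      rad (ideal_sum ring_of_type_algebra Q J)"
    using radical_mono radical_radical by (metis order_trans)
qed

text \<open>The primes that determine the height of a sum depend only on the set of radicals,
  because a prime contains an ideal exactly if it contains its radical.\<close>

lemma ideal_sum_subset_prime_iff:
  fixes Q :: "'i \<Rightarrow> 'a::comm_ring_1 set"
  assumes P: "primeideal P ring_of_type_algebra"
  shows "ideal_sum ring_of_type_algebra Q J \<subseteq> P \<longleftrightarrow> (\<forall>\<rho>\<in>(\<lambda>j. rad (Q j)) ` J. \<rho> \<subseteq> P)"
proof
  assume "ideal_sum ring_of_type_algebra Q J \<subseteq> P"
  then have "rad (Q j) \<subseteq> P" if "j \<in> J" for j
    using ideal_sum_upper[OF that, of Q] radical_subset_prime[OF P, of "Q j"] by blast
  then show "\<forall>\<rho>\<in>(\<lambda>j. rad (Q j)) ` J. \<rho> \<subseteq> P" by blast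
next
  assume "\<forall>\<rho>\<in>(\<lambda>j. rad (Q j)) ` J. \<rho> \<subseteq> P"
  then have "Q j \<subseteq> P" if "j \<in> J" for j using subset_radical[of "Q j"] that by blast
  then show "ideal_sum ring_of_type_algebra Q J \<subseteq> P"
    using primeideal.axioms(1)[OF P] by (intro ideal_sum_least)
qed

lemma height_ideal_sum_cong:
  fixes Q :: "'i \<Rightarrow> 'a::comm_ring_1 set" and Q' :: "'j \<Rightarrow> 'a set"
  assumes "(\<lambda>j. rad (Q j)) ` J = (\<lambda>j. rad (Q' j)) ` J'"
  shows "height ring_of_type_algebra (ideal_sum ring_of_type_algebra Q J) =
    height ring_of_type_algebra (ideal_sum ring_of_type_algebra Q' J')"
proof -
  have "{P. primeideal P ring_of_type_algebra \<and> ideal_sum ring_of_type_algebra Q J \<subseteq> P} =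
      {P. primeideal P ring_of_type_algebra \<and> ideal_sum ring_of_type_algebra Q' J' \<subseteq> P}"
    by (rule Collect_cong) (use assms in \<open>metis ideal_sum_subset_prime_iff\<close>)
  then show ?thesis unfolding height_def by simp
qed

text \<open>Index tuples are traded for tuples f of radicals; the right-hand side sees s and Q only
  through the set of radicals.\<close>

lemma size_v_eq_radicals:
  fixes Q :: "nat \<Rightarrow> ('n::finite, 'k::field) mpoly set"
  shows "size_v s Q = (LEAST t. t \<ge> 1 \<and> (\<exists>f :: nat \<Rightarrow> ('n, 'k) mpoly set.
    f ` {1..t} \<subseteq> (\<lambda>j. rad (Q j)) ` {1..s} \<and>
    rad (Idl\<^bsub>\<S>\<^esub> (\<Union> (f ` {1..t}))) = rad (Idl\<^bsub>\<S>\<^esub> (\<Union> ((\<lambda>j. rad (Q j)) ` {1..s})))))"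
proof -
  define \<rho> where "\<rho> = (\<lambda>j. rad (Q j))"
  have sum: "rad (ideal_sum \<S> (\<lambda>i. Q (j i)) J) = rad (Idl\<^bsub>\<S>\<^esub> (\<Union>i\<in>J. \<rho> (j i)))"
    for j :: "nat \<Rightarrow> nat" and J
    unfolding \<rho>_def by (subst radical_ideal_sum) (simp add: ideal_sum_def)
  have "(\<exists>j :: nat \<Rightarrow> nat. j ` {1..t} \<subseteq> {1..s} \<and>
      rad (ideal_sum \<S> (\<lambda>i. Q (j i)) {1..t}) = rad (ideal_sum \<S> Q {1..s})) \<longleftrightarrow>
    (\<exists>f. f ` {1..t} \<subseteq> \<rho> ` {1..s} \<and>
      rad (Idl\<^bsub>\<S>\<^esub> (\<Union> (f ` {1..t}))) = rad (Idl\<^bsub>\<S>\<^esub> (\<Union> (\<rho> ` {1..s}))))"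
    (is "?L \<longleftrightarrow> ?R") for t
  proof
    assume ?L
    then obtain j where j: "j ` {1..t} \<subseteq> {1..s}"
      "rad (ideal_sum \<S> (\<lambda>i. Q (j i)) {1..t}) = rad (ideal_sum \<S> Q {1..s})" by blast
    then show ?R
      unfolding sum sum[of "\<lambda>i. i"] by (intro exI[of _ "\<lambda>i. \<rho> (j i)"]) auto
  next
    assume ?R
    then obtain f where f: "f ` {1..t} \<subseteq> \<rho> ` {1..s}"
      "rad (Idl\<^bsub>\<S>\<^esub> (\<Union> (f ` {1..t}))) = rad (Idl\<^bsub>\<S>\<^esub> (\<Union> (\<rho> ` {1..s})))" by blast
    then have "\<forall>i\<in>{1..t}. \<exists>j\<in>{1..s}. f i = \<rho> j" by blast
    then obtain j where j: "\<And>i. i \<in> {1..t} \<Longrightarrow> j i \<in> {1..s} \<and> f i = \<rho> (j i)" by metis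
    then have "(\<Union> (f ` {1..t})) = (\<Union>i\<in>{1..t}. \<rho> (j i))" by simp
    then show ?L
      unfolding sum sum[of "\<lambda>i. i"] using j f(2) by (intro exI[of _ j]) auto
  qed
  then show ?thesis unfolding size_v_def \<rho>_def by simp
qed

lemma decomposition_size_cong:
  fixes Q Q' :: "nat \<Rightarrow> ('n::finite, 'k::field) mpoly set"
  assumes "(\<lambda>j. rad (Q j)) ` {1..s} = (\<lambda>j. rad (Q' j)) ` {1..s'}"
  shows "decomposition_size s Q = decomposition_size s' Q'"
  unfolding decomposition_size_def size_v_eq_radicals assms height_ideal_sum_cong[OF assms] ..

lemma primary_ideal_iff:
  "primary_ideal ring_of_type_algebra Q \<longleftrightarrow> ideal Q ring_of_type_algebra \<and> Q \<noteq> UNIV \<and>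
    (\<forall>a b. a * b \<in> Q \<longrightarrow> a \<in> Q \<or> b \<in> rad Q)"
  by (simp add: primary_ideal_def)

lemma radical_primary_mult:
  fixes Q :: "'a::comm_ring_1 set"
  assumes "primary_ideal ring_of_type_algebra Q" "a * b \<in> rad Q"
  shows "a \<in> rad Q \<or> b \<in> rad Q"
proof -
  obtain k where "a ^ k * b ^ k \<in> Q" using assms(2) by (auto simp: radical_iff power_mult_distrib)
  then have "a ^ k \<in> Q \<or> b ^ k \<in> rad Q" using assms(1) unfolding primary_ideal_iff by blast
  then show ?thesis using power_mem_radicalD[of b k Q] by (auto simp: radical_iff)
qed

text \<open>The radical of a primary ideal is prime. An element of \<open>\<rho> i\<close> outside
  \<open>rad Q\<close> multiplies the remaining intersection into \<open>rad Q\<close>, and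
  primality then removes that factor.\<close>

lemma Inter_subset_radical_primary:
  fixes Q :: "'a::comm_ring_1 set"
  assumes Q: "primary_ideal ring_of_type_algebra Q"
    and "finite N" "N \<noteq> {}" "\<And>j. j \<in> N \<Longrightarrow> ideal (\<rho> j) ring_of_type_algebra"
    and "(\<Inter>j\<in>N. \<rho> j) \<subseteq> rad Q"
  shows "\<exists>j\<in>N. \<rho> j \<subseteq> rad Q"
  using assms(2-)
proof (induction N rule: finite_ne_induct)
  case (insert i N)
  show ?case
  proof (cases "\<rho> i \<subseteq> rad Q")
    case False
    then obtain a where a: "a \<in> \<rho> i" "a \<notin> rad Q" by blast
    have "b \<in> rad Q" if "b \<in> (\<Inter>j\<in>N. \<rho> j)" for b
    proof -
      have "b * a \<in> \<rho> i" using insert.prems(1)[of i] a(1) ideal_mult_left by blast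
      moreover have "a * b \<in> \<rho> j" if "j \<in> N" for j
        using insert.prems(1)[of j] \<open>b \<in> _\<close> that ideal_mult_left by blast
      ultimately have "a * b \<in> rad Q" using insert.prems(2) by (auto simp: mult.commute)
      then show ?thesis using radical_primary_mult[OF Q] a(2) by blast
    qed
    then show ?thesis using insert.IH insert.prems(1) by blast
  qed blast
qed simp

text \<open>Saturations \<open>I : f\<^sup>\<infinity>\<close> recover the radicals of the components from \<open>I\<close> alone.\<close>
lemma saturation_Inter_primary:
  fixes Q :: "'i \<Rightarrow> 'a::comm_ring_1 set"
  assumes "finite J" "\<And>j. j \<in> J \<Longrightarrow> primary_ideal ring_of_type_algebra (Q j)"
  shows "(\<exists>k. a ^ k * f \<in> (\<Inter>j\<in>J. Q j)) \<longleftrightarrow> a \<in> (\<Inter>j\<in>{j \<in> J. f \<notin> Q j}. rad (Q j))"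
proof
  assume "\<exists>k. a ^ k * f \<in> (\<Inter>j\<in>J. Q j)"
  then obtain k where k: "\<And>j. j \<in> J \<Longrightarrow> a ^ k * f \<in> Q j" by blast
  have "a \<in> rad (Q j)" if "j \<in> J" "f \<notin> Q j" for j
  proof -
    have "f * a ^ k \<in> Q j" using k[OF that(1)] by (simp add: mult.commute)
    then have "a ^ k \<in> rad (Q j)" using assms(2)[OF that(1)] that(2) unfolding primary_ideal_iff by blast
    then show ?thesis by (rule power_mem_radicalD)
  qed
  then show "a \<in> (\<Inter>j\<in>{j \<in> J. f \<notin> Q j}. rad (Q j))" by blast
next
  assume a: "a \<in> (\<Inter>j\<in>{j \<in> J. f \<notin> Q j}. rad (Q j))"
  have "\<exists>k. a ^ k * f \<in> Q j" if j: "j \<in> J" for j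
  proof (cases "f \<in> Q j")
    case True
    then show ?thesis by (intro exI[of _ 0]) simp
  next
    case False
    then obtain k where "a ^ k \<in> Q j" using a j by (auto simp: radical_iff)
    then have "f * a ^ k \<in> Q j"
      using assms(2)[OF j] ideal_mult_left unfolding primary_ideal_iff by blast
    then show ?thesis by (auto simp: mult.commute)
  qed
  then obtain k where k: "\<And>j. j \<in> J \<Longrightarrow> a ^ k j * f \<in> Q j" by metis
  \<comment> \<open>The sum of the finitely many exponents serves all components at once.\<close>
  have "a ^ sum k J * f \<in> Q j" if "j \<in> J" for j
  proof -
    have "k j \<le> sum k J" using assms(1) that by (simp add: member_le_sum)
    then have "a ^ sum k J = a ^ (sum k J - k j) * a ^ k j" by (simp flip: power_add)
    then have "a ^ sum k J * f = a ^ (sum k J - k j) * (a ^ k j * f)" by (simp add: mult.assoc)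
    then show ?thesis using k[OF that] assms(2)[OF that] ideal_mult_left unfolding primary_ideal_iff by metis
  qed
  then show "\<exists>k. a ^ k * f \<in> (\<Inter>j\<in>J. Q j)" by blast
qed

text \<open>Irredundance supplies f outside \<open>Q i\<close> but in all other components. The
  radical of I : f is then \<open>rad (Q i)\<close> by the first decomposition and a finite
  intersection of radicals \<open>rad (Q' j)\<close> by the second; being prime, it equals one of
  them.\<close>

lemma radicals_irredundant_subset:
  fixes Q Q' :: "nat \<Rightarrow> 'a::comm_ring_1 set"
  assumes prim: "\<And>j. j \<in> {1..s} \<Longrightarrow> primary_ideal ring_of_type_algebra (Q j)"
    and prim': "\<And>j. j \<in> {1..s'} \<Longrightarrow> primary_ideal ring_of_type_algebra (Q' j)"
    and irr: "irredundant_presentation s Q I" and irr': "irredundant_presentation s' Q' I"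
  shows "(\<lambda>j. rad (Q j)) ` {1..s} \<subseteq> (\<lambda>j. rad (Q' j)) ` {1..s'}"
proof
  fix \<rho> assume "\<rho> \<in> (\<lambda>j. rad (Q j)) ` {1..s}"
  then obtain i where i: "i \<in> {1..s}" "\<rho> = rad (Q i)" by blast
  have I: "I = (\<Inter>j\<in>{1..s}. Q j)" "I = (\<Inter>j\<in>{1..s'}. Q' j)"
    using irr irr' unfolding irredundant_presentation_def by blast+
  have "(\<Inter>j\<in>{1..s} - {i}. Q j) \<noteq> I" using irr i(1) unfolding irredundant_presentation_def by blast
  moreover have "I \<subseteq> (\<Inter>j\<in>{1..s} - {i}. Q j)" unfolding I(1) by blast
  ultimately obtain f where f: "f \<in> (\<Inter>j\<in>{1..s} - {i}. Q j)" "f \<notin> I" by blast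
  have "{j \<in> {1..s}. f \<notin> Q j} = {i}" using f i(1) unfolding I(1) by auto
  then have sat: "\<rho> = {a. \<exists>k. a ^ k * f \<in> I}"
    using saturation_Inter_primary[of "{1..s}" Q _ f] prim i(2) unfolding I(1) by auto
  let ?N = "{j \<in> {1..s'}. f \<notin> Q' j}"
  have eq: "\<rho> = (\<Inter>j\<in>?N. rad (Q' j))"
    unfolding sat I(2) using saturation_Inter_primary[of "{1..s'}" Q' _ f] prim' by auto
  have "?N \<noteq> {}" using f(2) unfolding I(2) by blast
  then have "\<exists>j\<in>?N. rad (Q' j) \<subseteq> rad (Q i)"
  proof (rule Inter_subset_radical_primary[OF prim[OF i(1)], rotated])
    show "ideal (rad (Q' j)) ring_of_type_algebra" if "j \<in> ?N" for j
      using prim'[of j] that by (intro radical_ideal) (simp add: primary_ideal_iff)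
    show "(\<Inter>j\<in>?N. rad (Q' j)) \<subseteq> rad (Q i)" using eq i(2) by blast
  qed simp_all
  then show "\<rho> \<in> (\<lambda>j. rad (Q' j)) ` {1..s'}"
    using eq i(2) by blast
qed

text \<open>Justifies the definite description: two decompositions have the same radicals, hence the
  same v and the same height.\<close>

lemma ideal_size_eq:
  assumes "monomial_primary_decomposition s Q I"
  shows "ideal_size I = decomposition_size s Q"
  unfolding ideal_size_def
proof (rule the_equality)
  fix z assume "\<exists>s Q. monomial_primary_decomposition s Q I \<and> z = decomposition_size s Q"
  then obtain s' Q' where Q': "monomial_primary_decomposition s' Q' I" "z = decomposition_size s' Q'"
    by blast
  then have "(\<lambda>j. rad (Q j)) ` {1..s} = (\<lambda>j. rad (Q' j)) ` {1..s'}"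
    using assms unfolding monomial_primary_decomposition_def
    by (intro antisym radicals_irredundant_subset) auto
  then show "z = decomposition_size s Q" using Q'(2) decomposition_size_cong by metis
qed (use assms in blast)

subsection \<open>Stanley decompositions from cone partitions\<close>

lemma coset_eq_iff:
  fixes I :: "'a::comm_ring_1 set"
  assumes "ideal I ring_of_type_algebra"
  shows "I +>\<^bsub>ring_of_type_algebra\<^esub> p = I +>\<^bsub>ring_of_type_algebra\<^esub> q \<longleftrightarrow> p - q \<in> I"
proof -
  interpret cring "ring_of_type_algebra :: 'a ring" by (rule cring_from_type_algebra)
  show ?thesis
    using quotient_eq_iff_same_a_r_cos[OF assms, of p q] by (simp add: a_minus_def)
qed

lemma carrier_quotient_module:
  "carrier (quotient_module ring_of_type_algebra I) = range (\<lambda>p. I +>\<^bsub>ring_of_type_algebra\<^esub> p)"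
  by (auto simp: quotient_module_def FactRing_def A_RCOSETS_def RCOSETS_def a_r_coset_def)

lemma add_quotient_module:
  fixes I :: "'a::comm_ring_1 set"
  assumes "ideal I ring_of_type_algebra"
  shows "(I +>\<^bsub>ring_of_type_algebra\<^esub> p) \<oplus>\<^bsub>quotient_module ring_of_type_algebra I\<^esub> (I +>\<^bsub>ring_of_type_algebra\<^esub> q) =
    I +>\<^bsub>ring_of_type_algebra\<^esub> (p + q)"
proof -
  interpret ideal I "ring_of_type_algebra :: 'a ring" by fact
  show ?thesis using a_rcos_sum[of p q] by (simp add: quotient_module_def FactRing_def)
qed

lemma smult_quotient_module:
  fixes I :: "'a::comm_ring_1 set"
  assumes "ideal I ring_of_type_algebra"
  shows "r \<odot>\<^bsub>quotient_module ring_of_type_algebra I\<^esub> (I +>\<^bsub>ring_of_type_algebra\<^esub> p) =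
    I +>\<^bsub>ring_of_type_algebra\<^esub> (r * p)"
proof -
  interpret ideal I "ring_of_type_algebra :: 'a ring" by fact
  show ?thesis using rcoset_mult_add[of r p] by (simp add: quotient_module_def FactRing_def)
qed

lemma zero_quotient_module:
  fixes I :: "'a::comm_ring_1 set"
  assumes "ideal I ring_of_type_algebra"
  shows "\<zero>\<^bsub>quotient_module ring_of_type_algebra I\<^esub> = I +>\<^bsub>ring_of_type_algebra\<^esub> 0"
proof -
  interpret ideal I "ring_of_type_algebra :: 'a ring" by fact
  show ?thesis
    using a_rcos_zero[OF assms, of 0] additive_subgroup.zero_closed[OF is_additive_subgroup]
    by (simp add: quotient_module_def FactRing_def)
qed

lemma finsum_quotient_module:
  fixes I :: "'a::comm_ring_1 set"
  assumes I: "ideal I ring_of_type_algebra" and "finite A"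
    and f: "\<And>i. i \<in> A \<Longrightarrow> f i = I +>\<^bsub>ring_of_type_algebra\<^esub> g i"
  shows "(\<Oplus>\<^bsub>quotient_module ring_of_type_algebra I\<^esub>i\<in>A. f i) = I +>\<^bsub>ring_of_type_algebra\<^esub> sum g A"
proof -
  interpret M: module "ring_of_type_algebra :: 'a ring" "quotient_module ring_of_type_algebra I"
    by (rule quotient_module_is_module[OF cring_from_type_algebra I])
  show ?thesis
    using assms(2,3)
  proof (induction A rule: finite_induct)
    case empty
    then show ?case by (simp add: zero_quotient_module[OF I])
  next
    case (insert i A)
    have "(\<Oplus>\<^bsub>quotient_module ring_of_type_algebra I\<^esub>j\<in>insert i A. f j) =
        f i \<oplus>\<^bsub>quotient_module ring_of_type_algebra I\<^esub> (\<Oplus>\<^bsub>quotient_module ring_of_type_algebra I\<^esub>j\<in>A. f j)"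
      by (rule M.finsum_insert) (use insert in \<open>auto simp: carrier_quotient_module\<close>)
    then show ?case using insert by (simp add: add_quotient_module[OF I])
  qed
qed

section \<open>Monomial cones and the subrings K[Z]\<close>

definition monomial_cone :: "('n::finite \<Rightarrow>\<^sub>0 nat) \<Rightarrow> 'n set \<Rightarrow> ('n \<Rightarrow>\<^sub>0 nat) set"
  where "monomial_cone m Z = {m + w | w. Poly_Mapping.keys w \<subseteq> Z}"

lemma monomial_cone_iff:
  "x \<in> monomial_cone m Z \<longleftrightarrow> Poly_Mapping.lookup x \<in> exponent_cone UNIV (Poly_Mapping.lookup m, Z)"
proof
  assume "Poly_Mapping.lookup x \<in> exponent_cone UNIV (Poly_Mapping.lookup m, Z)"
  then have *: "if k \<in> Z then Poly_Mapping.lookup m k \<le> Poly_Mapping.lookup x k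
      else Poly_Mapping.lookup x k = Poly_Mapping.lookup m k" for k
    unfolding exponent_cone_def mem_Collect_eq fst_conv snd_conv by (rule bspec[OF _ UNIV_I])
  have "x = m + (x - m)"
  proof (rule poly_mapping_eqI)
    show "Poly_Mapping.lookup x k = Poly_Mapping.lookup (m + (x - m)) k" for k
      using *[of k] by (simp add: lookup_add lookup_minus split: if_splits)
  qed
  moreover have "Poly_Mapping.keys (x - m) \<subseteq> Z"
  proof
    fix k assume "k \<in> Poly_Mapping.keys (x - m)"
    then show "k \<in> Z" using *[of k] by (auto simp: in_keys_iff lookup_minus split: if_splits)
  qed
  ultimately show "x \<in> monomial_cone m Z" unfolding monomial_cone_def by blast
next
  assume "x \<in> monomial_cone m Z"
  then obtain w where "x = m + w" "Poly_Mapping.keys w \<subseteq> Z" unfolding monomial_cone_def by blast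
  then show "Poly_Mapping.lookup x \<in> exponent_cone UNIV (Poly_Mapping.lookup m, Z)"
    unfolding exponent_cone_def by (auto simp: lookup_add in_keys_iff)
qed

lemma monomial_cone_addI: "Poly_Mapping.keys w \<subseteq> Z \<Longrightarrow> w + m \<in> monomial_cone m Z"
  unfolding monomial_cone_def by (intro CollectI exI[of _ w]) (simp add: add.commute)

lemma poly_subring_add: "p \<in> poly_subring Z \<Longrightarrow> q \<in> poly_subring Z \<Longrightarrow> p + q \<in> poly_subring Z"
  unfolding poly_subring_def using Poly_Mapping.keys_add[of p q] by blast

lemma poly_subring_zero: "0 \<in> poly_subring Z"
  by (simp add: poly_subring_def)

lemma poly_subring_one: "1 \<in> poly_subring Z"
  by (simp add: poly_subring_def)

lemma poly_subring_uminus: "p \<in> poly_subring Z \<Longrightarrow> - p \<in> poly_subring Z"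
  by (simp add: poly_subring_def in_keys_iff)

lemma poly_subring_mult:
  assumes "p \<in> poly_subring Z" "q \<in> poly_subring Z"
  shows "p * q \<in> poly_subring Z"
  unfolding poly_subring_def
proof (intro CollectI ballI)
  fix m assume "m \<in> Poly_Mapping.keys (p * q)"
  then obtain a b where "a \<in> Poly_Mapping.keys p" "b \<in> Poly_Mapping.keys q" "m = a + b"
    using keys_mult[of p q] by blast
  then show "Poly_Mapping.keys m \<subseteq> Z"
    using assms Poly_Mapping.keys_add[of a b] unfolding poly_subring_def by blast
qed

lemma poly_subring_sum: "(\<And>i. i \<in> A \<Longrightarrow> f i \<in> poly_subring Z) \<Longrightarrow> sum f A \<in> poly_subring Z"
  by (induction A rule: infinite_finite_induct) (auto intro: poly_subring_zero poly_subring_add)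

lemma poly_subring_cring: "cring (\<S>\<lparr>carrier := poly_subring Z :: ('n::finite, 'k::field) mpoly set\<rparr>)"
proof (rule cringI)
  let ?R = "\<S>\<lparr>carrier := poly_subring Z :: ('n, 'k) mpoly set\<rparr>"
  show "abelian_group ?R"
  proof (rule abelian_groupI)
    show "\<exists>q\<in>carrier ?R. q \<oplus>\<^bsub>?R\<^esub> p = \<zero>\<^bsub>?R\<^esub>" if "p \<in> carrier ?R" for p
      using that by (intro bexI[of _ "- p"]) (auto simp: poly_subring_uminus)
  qed (auto simp: poly_subring_zero poly_subring_add add.assoc add.commute)
  show "comm_monoid ?R"
    by (rule comm_monoidI) (auto simp: poly_subring_one poly_subring_mult mult.assoc mult.commute)
qed (auto simp: distrib_right)

lemma poly_subring_times_monomial: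
  "(\<lambda>p. p * monomial m) ` poly_subring Z =
    (monomial_span (monomial_cone m Z) :: ('n::finite, 'k::field) mpoly set)"
proof (intro equalityI subsetI)
  fix p :: "('n, 'k) mpoly" assume "p \<in> (\<lambda>p. p * monomial m) ` poly_subring Z"
  then obtain q where q: "q \<in> poly_subring Z" "p = q * monomial m" by blast
  have "x \<in> monomial_cone m Z" if "x \<in> Poly_Mapping.keys p" for x
  proof -
    obtain w where "w \<in> Poly_Mapping.keys q" "x = w + m"
      using keys_mult[of q "monomial m"] \<open>x \<in> _\<close> unfolding q(2) by (auto simp: monomial_def)
    then show ?thesis
      using q(1) monomial_cone_addI unfolding poly_subring_def by blast
  qed
  then show "p \<in> monomial_span (monomial_cone m Z)" unfolding monomial_span_def by blast
next
  fix p :: "('n, 'k) mpoly" assume p: "p \<in> monomial_span (monomial_cone m Z)"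
  let ?q = "\<Sum>x\<in>Poly_Mapping.keys p. Poly_Mapping.single (x - m) (Poly_Mapping.lookup p x)"
  have x: "x - m + m = x \<and> Poly_Mapping.keys (x - m) \<subseteq> Z" if "x \<in> Poly_Mapping.keys p" for x
  proof -
    obtain w where "x = m + w" "Poly_Mapping.keys w \<subseteq> Z"
      using p \<open>x \<in> _\<close> unfolding monomial_span_def monomial_cone_def by blast
    then show ?thesis by (simp add: add.commute)
  qed
  have "?q \<in> poly_subring Z"
    by (rule poly_subring_sum) (use x in \<open>auto simp: poly_subring_def\<close>)
  moreover have "p = ?q * monomial m"
  proof -
    have "?q * monomial m = (\<Sum>x\<in>Poly_Mapping.keys p. Poly_Mapping.single x (Poly_Mapping.lookup p x))"
      unfolding sum_distrib_right by (rule sum.cong) (use x in \<open>auto simp: monomial_def mult_single\<close>)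
    then show ?thesis using poly_mapping_eq_sum_single[of p] by simp
  qed
  ultimately show "p \<in> (\<lambda>p. p * monomial m) ` poly_subring Z" by blast
qed

lemma stanley_carrier_quotient:
  fixes I :: "('n::finite, 'k::field) mpoly set"
  assumes "ideal I \<S>"
  shows "stanley_carrier (quotient_module \<S> I) (I +>\<^bsub>\<S>\<^esub> monomial m) Z =
    (\<lambda>p. I +>\<^bsub>\<S>\<^esub> p) ` monomial_span (monomial_cone m Z)"
  unfolding stanley_carrier_def smult_quotient_module[OF assms]
  unfolding poly_subring_times_monomial[symmetric] by (simp add: image_image)

text \<open>The class of the monomial is a one-element basis: multiplying it by elements of K[Z] is
  injective because the exponents land in the cone, which avoids E.\<close>

lemma stanley_space_monomial:
  fixes E :: "('n::finite \<Rightarrow>\<^sub>0 nat) set"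
  defines "I \<equiv> monomial_span E :: ('n, 'k::field) mpoly set"
  assumes I: "ideal I \<S>" and disj: "monomial_cone m Z \<inter> E = {}"
  shows "stanley_space (quotient_module \<S> I) (quotient_component I) (I +>\<^bsub>\<S>\<^esub> monomial m) Z"
proof -
  let ?M = "quotient_module \<S> I"
  let ?R = "\<S>\<lparr>carrier := poly_subring Z :: ('n, 'k) mpoly set\<rparr>"
  let ?u = "I +>\<^bsub>\<S>\<^esub> monomial m"
  let ?C = "stanley_carrier ?M ?u Z"
  let ?N = "?M\<lparr>carrier := ?C\<rparr>"
  let ?c = "\<lambda>p. I +>\<^bsub>\<S>\<^esub> p"
  interpret M: module "\<S> :: ('n, 'k) mpoly ring" ?M
    by (rule quotient_module_is_module[OF cring_from_type_algebra I])
  have smult: "p \<odot>\<^bsub>?M\<^esub> ?c q = ?c (p * q)" for p q by (rule smult_quotient_module[OF I])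
  have add: "?c p \<oplus>\<^bsub>?M\<^esub> ?c q = ?c (p + q)" for p q by (rule add_quotient_module[OF I])
  have zero: "\<zero>\<^bsub>?M\<^esub> = ?c 0" by (rule zero_quotient_module[OF I])
  have C: "x \<in> ?C \<longleftrightarrow> (\<exists>p\<in>poly_subring Z. x = ?c (p * monomial m))" for x
    unfolding stanley_carrier_def smult by blast
  have C_M: "x \<in> carrier ?M" if "x \<in> ?C" for x
    using that unfolding C carrier_quotient_module by blast
  have group: "abelian_group ?N"
  proof (rule abelian_groupI)
    fix x y assume "x \<in> carrier ?N" "y \<in> carrier ?N"
    then obtain p q where "p \<in> poly_subring Z" "x = ?c (p * monomial m)"
      "q \<in> poly_subring Z" "y = ?c (q * monomial m)" by (auto simp: C)
    then show "x \<oplus>\<^bsub>?N\<^esub> y \<in> carrier ?N"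
      by (auto simp: C add intro!: bexI[of _ "p + q"] poly_subring_add simp: distrib_right)
  next
    show "\<zero>\<^bsub>?N\<^esub> \<in> carrier ?N"
      by (auto simp: C zero intro!: bexI[of _ 0] poly_subring_zero)
  next
    fix x assume "x \<in> carrier ?N"
    then obtain p where p: "p \<in> poly_subring Z" "x = ?c (p * monomial m)" by (auto simp: C)
    have "?c (- p * monomial m) \<in> carrier ?N"
      using poly_subring_uminus[OF p(1)] C[of "?c (- p * monomial m)"] by (simp del: mult_minus_left) blast
    moreover have "?c (- p * monomial m) \<oplus>\<^bsub>?N\<^esub> x = \<zero>\<^bsub>?N\<^esub>"
      by (simp add: p(2) add zero)
    ultimately show "\<exists>y\<in>carrier ?N. y \<oplus>\<^bsub>?N\<^esub> x = \<zero>\<^bsub>?N\<^esub>" by blast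
  qed (auto dest!: C_M simp: M.a_ac)
  have module: "module ?R ?N"
  proof (rule moduleI[OF poly_subring_cring group])
    fix p x assume "p \<in> carrier ?R" "x \<in> carrier ?N"
    then obtain q where "p \<in> poly_subring Z" "q \<in> poly_subring Z" "x = ?c (q * monomial m)"
      by (auto simp: C)
    then show "p \<odot>\<^bsub>?N\<^esub> x \<in> carrier ?N"
      by (auto simp: C smult mult.assoc[symmetric] intro!: bexI[of _ "p * q"] poly_subring_mult)
  qed (auto dest!: C_M simp: M.smult_l_distr[simplified] M.smult_r_distr[simplified]
      M.smult_assoc1[simplified] M.smult_one[simplified])
  interpret N: module ?R ?N by (rule module)
  have inj: "p = q" if pq: "p \<in> poly_subring Z" "q \<in> poly_subring Z" "p \<odot>\<^bsub>?M\<^esub> ?u = q \<odot>\<^bsub>?M\<^esub> ?u" for p q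
  proof -
    let ?r = "p - q"
    have r: "?r \<in> poly_subring Z"
      using poly_subring_add[OF pq(1) poly_subring_uminus[OF pq(2)]] by simp
    have "p * monomial m - q * monomial m \<in> I" using pq(3) unfolding smult coset_eq_iff[OF I] .
    then have rI: "?r * monomial m \<in> I" by (simp add: left_diff_distrib)
    have "w \<notin> Poly_Mapping.keys ?r" for w
    proof
      assume w: "w \<in> Poly_Mapping.keys ?r"
      have "Poly_Mapping.lookup (?r * monomial m) (w + m) =
          Poly_Mapping.lookup ?r w * Poly_Mapping.lookup (monomial m :: ('n, 'k) mpoly) m"
        by (rule lookup_mult_unique[OF w]) (auto simp: monomial_def)
      then have "w + m \<in> Poly_Mapping.keys (?r * monomial m)"
        using w by (simp add: in_keys_iff monomial_def)
      then have "w + m \<in> E" using rI unfolding I_def monomial_span_def by blast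
      moreover have "w + m \<in> monomial_cone m Z"
        using w r unfolding poly_subring_def by (blast intro: monomial_cone_addI)
      ultimately show False using disj by blast
    qed
    then have "?r = 0" by (intro poly_mapping_eqI) (simp add: in_keys_iff)
    then show ?thesis by simp
  qed
  have u: "?u \<in> ?C" unfolding C by (rule bexI[of _ 1]) (auto simp: poly_subring_one)
  \<comment> \<open>The sum in \<open>free_module\<close> runs over nonzero coefficients only, so it
    is empty when c vanishes at the basis element.\<close>
  have sum: "(\<Oplus>\<^bsub>?N\<^esub>b\<in>{b\<in>{?u}. c b \<noteq> \<zero>\<^bsub>?R\<^esub>}. c b \<odot>\<^bsub>?N\<^esub> b) = c ?u \<odot>\<^bsub>?M\<^esub> ?u"
    if c: "c \<in> {?u} \<rightarrow>\<^sub>E carrier ?R" for c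
  proof (cases "c ?u = 0")
    case True
    then have "{b\<in>{?u}. c b \<noteq> \<zero>\<^bsub>?R\<^esub>} = {}" by auto
    then show ?thesis using True by (simp only: N.finsum_empty) (simp add: smult zero)
  next
    case False
    then have *: "{b\<in>{?u}. c b \<noteq> \<zero>\<^bsub>?R\<^esub>} = insert ?u {}" by auto
    have "c ?u \<odot>\<^bsub>?N\<^esub> ?u \<in> carrier ?N"
      by (rule N.smult_closed) (use c u in auto)
    then have "(\<Oplus>\<^bsub>?N\<^esub>b\<in>insert ?u {}. c b \<odot>\<^bsub>?N\<^esub> b) = c ?u \<odot>\<^bsub>?N\<^esub> ?u"
      using C_M by (subst N.finsum_insert) simp_all
    then show ?thesis unfolding * by simp
  qed
  have "\<exists>!c. c \<in> {?u} \<rightarrow>\<^sub>E carrier ?R \<and> finite {b\<in>{?u}. c b \<noteq> \<zero>\<^bsub>?R\<^esub>} \<and>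
      x = (\<Oplus>\<^bsub>?N\<^esub>b\<in>{b\<in>{?u}. c b \<noteq> \<zero>\<^bsub>?R\<^esub>}. c b \<odot>\<^bsub>?N\<^esub> b)" if x: "x \<in> carrier ?N" for x
  proof -
    obtain p where p: "p \<in> poly_subring Z" "x = p \<odot>\<^bsub>?M\<^esub> ?u"
      using x unfolding stanley_carrier_def by auto
    let ?c0 = "\<lambda>b\<in>{?u}. p"
    have c0: "?c0 \<in> {?u} \<rightarrow>\<^sub>E carrier ?R" using p(1) by auto
    show ?thesis
    proof (rule ex1I[of _ ?c0])
      show "?c0 \<in> {?u} \<rightarrow>\<^sub>E carrier ?R \<and> finite {b\<in>{?u}. ?c0 b \<noteq> \<zero>\<^bsub>?R\<^esub>} \<and>
          x = (\<Oplus>\<^bsub>?N\<^esub>b\<in>{b\<in>{?u}. ?c0 b \<noteq> \<zero>\<^bsub>?R\<^esub>}. ?c0 b \<odot>\<^bsub>?N\<^esub> b)"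
        unfolding sum[OF c0] using c0 p(2) by simp
    next
      fix c assume c: "c \<in> {?u} \<rightarrow>\<^sub>E carrier ?R \<and> finite {b\<in>{?u}. c b \<noteq> \<zero>\<^bsub>?R\<^esub>} \<and>
          x = (\<Oplus>\<^bsub>?N\<^esub>b\<in>{b\<in>{?u}. c b \<noteq> \<zero>\<^bsub>?R\<^esub>}. c b \<odot>\<^bsub>?N\<^esub> b)"
      then have c1: "c \<in> {?u} \<rightarrow>\<^sub>E carrier ?R" by blast
      have "x = c ?u \<odot>\<^bsub>?M\<^esub> ?u" using c sum[OF c1] by simp
      then have "c ?u = p" using c1 p by (intro inj) auto
      then show "c = ?c0" by (intro PiE_ext[OF c1 c0]) simp
    qed
  qed
  then have "free_module ?R ?N"
    unfolding free_module_def using module u by (intro conjI exI[of _ "{?u}"]) auto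
  moreover have "?u \<in> quotient_component I (\<lambda>i. int (Poly_Mapping.lookup m i))"
    unfolding quotient_component_def poly_component_def monomial_def by (intro imageI) simp
  ultimately show ?thesis
    unfolding stanley_space_def using C_M[OF u] by blast
qed

text \<open>Coefficients at exponents outside E are determined modulo I, so an element splits
  uniquely by distributing these terms over the cones.\<close>

lemma stanley_decomposition_monomial_cones:
  fixes E :: "('n::finite \<Rightarrow>\<^sub>0 nat) set" and ds :: "(('n \<Rightarrow>\<^sub>0 nat) \<times> 'n set) list"
  defines "I \<equiv> monomial_span E :: ('n, 'k::field) mpoly set"
  assumes I: "ideal I \<S>"
    and union: "- E = (\<Union>i<length ds. monomial_cone (fst (ds ! i)) (snd (ds ! i)))"
    and disj: "disjoint_family_on (\<lambda>i. monomial_cone (fst (ds ! i)) (snd (ds ! i))) {..<length ds}"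
  shows "stanley_decomposition (quotient_module \<S> I) (quotient_component I)
    (map (\<lambda>(m, Z). (I +>\<^bsub>\<S>\<^esub> monomial m, Z)) ds)"
  unfolding stanley_decomposition_def
proof (intro conjI ballI)
  define K where "K = (\<lambda>i. monomial_cone (fst (ds ! i)) (snd (ds ! i)))"
  let ?N = "{..<length ds}"
  let ?M = "quotient_module \<S> I"
  let ?c = "\<lambda>p. I +>\<^bsub>\<S>\<^esub> p"
  let ?D = "map (\<lambda>(m, Z). (?c (monomial m), Z)) ds"
  have KE: "K i \<inter> E = {}" if "i \<in> ?N" for i using union that unfolding K_def by blast
  show "case x of (u, Z) \<Rightarrow> stanley_space ?M (quotient_component I) u Z" if x: "x \<in> set ?D" for x
  proof -
    obtain i where "i \<in> ?N" "x = (?c (monomial (fst (ds ! i))), snd (ds ! i))"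
      using x by (auto simp: in_set_conv_nth case_prod_beta)
    then show ?thesis
      using stanley_space_monomial[of E "fst (ds ! i)" "snd (ds ! i)", where 'k = 'k] I KE
      unfolding I_def K_def by simp
  qed
  have carrier: "stanley_carrier ?M (fst (?D ! i)) (snd (?D ! i)) = ?c ` monomial_span (K i)"
    if "i \<in> ?N" for i
    using that stanley_carrier_quotient[OF I, of "fst (ds ! i)" "snd (ds ! i)"]
    by (simp add: case_prod_beta K_def)
  have PiE: "(\<Pi>\<^sub>E i\<in>{..<length ?D}. stanley_carrier ?M (fst (?D ! i)) (snd (?D ! i))) =
      (\<Pi>\<^sub>E i\<in>?N. ?c ` monomial_span (K i))"
    by (simp only: length_map) (rule PiE_cong, rule carrier)
  have lookup_sum_K: "Poly_Mapping.lookup (sum g ?N) m = Poly_Mapping.lookup (g i) m"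
    if g: "\<And>j. j \<in> ?N \<Longrightarrow> g j \<in> monomial_span (K j)" and i: "i \<in> ?N" "m \<in> K i"
    for g :: "nat \<Rightarrow> ('n, 'k) mpoly" and i m
  proof -
    have "Poly_Mapping.lookup (g j) m = 0" if j: "j \<in> ?N - {i}" for j
    proof -
      have "m \<notin> K j" using disj i j unfolding disjoint_family_on_def K_def by blast
      then show ?thesis using g[of j] j unfolding monomial_span_def by (auto simp: in_keys_iff)
    qed
    then have "(\<Sum>j\<in>?N. Poly_Mapping.lookup (g j) m) = (\<Sum>j\<in>{i}. Poly_Mapping.lookup (g j) m)"
      using i by (intro sum.mono_neutral_right) auto
    then show ?thesis by (simp add: lookup_sum)
  qed
  fix x assume "x \<in> carrier ?M"
  then obtain p where p: "x = ?c p" unfolding carrier_quotient_module by blast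
  \<comment> \<open>Terms of p with exponents in E belong to no cone; dropping them changes p by an
    element of I.\<close>
  define g where "g = (\<lambda>i. restrict_poly (K i) p)"
  have g: "g i \<in> monomial_span (K i)" for i
    unfolding g_def monomial_span_def by (simp add: keys_restrict_poly)
  have "p - sum g ?N \<in> I"
    unfolding I_def monomial_span_def
  proof (intro CollectI subsetI)
    fix m assume m: "m \<in> Poly_Mapping.keys (p - sum g ?N)"
    show "m \<in> E"
    proof (rule ccontr)
      assume "m \<notin> E"
      then obtain i where i: "i \<in> ?N" "m \<in> K i" using union unfolding K_def by blast
      then have "Poly_Mapping.lookup (sum g ?N) m = Poly_Mapping.lookup p m"
        using lookup_sum_K[OF g i] by (simp add: g_def lookup_restrict_poly)
      then show False using m by (simp add: in_keys_iff lookup_minus)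
    qed
  qed
  then have x: "x = ?c (sum g ?N)" unfolding p coset_eq_iff[OF I] .
  show "\<exists>!f. f \<in> (\<Pi>\<^sub>E i\<in>{..<length ?D}. stanley_carrier ?M (fst (?D ! i)) (snd (?D ! i))) \<and>
      x = (\<Oplus>\<^bsub>?M\<^esub>i\<in>{..<length ?D}. f i)"
    unfolding PiE unfolding length_map
  proof (rule ex1I[of _ "\<lambda>i\<in>?N. ?c (g i)"])
    have "(\<Oplus>\<^bsub>?M\<^esub>i\<in>?N. (\<lambda>i\<in>?N. ?c (g i)) i) = ?c (sum g ?N)"
      by (rule finsum_quotient_module[OF I]) simp_all
    then show "(\<lambda>i\<in>?N. ?c (g i)) \<in> (\<Pi>\<^sub>E i\<in>?N. ?c ` monomial_span (K i)) \<and>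
        x = (\<Oplus>\<^bsub>?M\<^esub>i\<in>?N. (\<lambda>i\<in>?N. ?c (g i)) i)"
      using g x by simp
  next
    fix f assume f: "f \<in> (\<Pi>\<^sub>E i\<in>?N. ?c ` monomial_span (K i)) \<and> x = (\<Oplus>\<^bsub>?M\<^esub>i\<in>?N. f i)"
    then have "\<forall>i\<in>?N. \<exists>q\<in>monomial_span (K i). f i = ?c q" by (auto simp: PiE_iff)
    then obtain h where h: "\<And>i. i \<in> ?N \<Longrightarrow> h i \<in> monomial_span (K i) \<and> f i = ?c (h i)" by metis
    have "(\<Oplus>\<^bsub>?M\<^esub>i\<in>?N. f i) = ?c (sum h ?N)"
      by (rule finsum_quotient_module[OF I]) (use h in auto)
    then have diff: "sum h ?N - sum g ?N \<in> I"
      using f x coset_eq_iff[OF I, of "sum h ?N" "sum g ?N"] by simp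
    \<comment> \<open>Both vanish off \<open>K i\<close>. On \<open>K i\<close> no other summand
      contributes, so their coefficients are those of the two sums, which agree outside E.\<close>
    have "h i = g i" if i: "i \<in> ?N" for i
    proof (rule poly_mapping_eqI)
      fix m
      show "Poly_Mapping.lookup (h i) m = Poly_Mapping.lookup (g i) m"
      proof (cases "m \<in> K i")
        case True
        have "m \<notin> E" using KE[OF i] True by blast
        then have "Poly_Mapping.lookup (sum h ?N - sum g ?N) m = 0"
          using diff unfolding I_def monomial_span_def by (auto simp: in_keys_iff)
        moreover have "Poly_Mapping.lookup (sum h ?N) m = Poly_Mapping.lookup (h i) m"
          using h by (intro lookup_sum_K i True) blast
        moreover have "Poly_Mapping.lookup (sum g ?N) m = Poly_Mapping.lookup (g i) m"
          by (intro lookup_sum_K i True g)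
        ultimately show ?thesis by (simp add: lookup_minus)
      next
        case False
        then have "m \<notin> Poly_Mapping.keys (h i)" "m \<notin> Poly_Mapping.keys (g i)"
          using h[OF i] g[of i] unfolding monomial_span_def by blast+
        then show ?thesis by (simp add: in_keys_iff)
      qed
    qed
    then show "f = (\<lambda>i\<in>?N. ?c (g i))"
      using f h by (intro extensionalityI[of _ ?N]) (auto simp: PiE_iff)
  qed
qed

lemma sdepth_quotient_ge:
  fixes E :: "('n::finite \<Rightarrow>\<^sub>0 nat) set"
  defines "I \<equiv> monomial_span E :: ('n, 'k::field) mpoly set"
  assumes I: "ideal I \<S>" and proper: "E \<noteq> UNIV"
    and part: "cone_partitionable UNIV d {u. Abs_poly_mapping u \<notin> E}"
  shows "d \<le> sdepth_quotient I"
proof -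
  \<comment> \<open>Every function on the finite type of variables has finite support.\<close>
  have lookup: "Poly_Mapping.lookup (Abs_poly_mapping u) = u" for u :: "'n \<Rightarrow> nat"
    by (rule Abs_poly_mapping_inverse) simp
  obtain D where D: "cone_partition UNIV d {u. Abs_poly_mapping u \<notin> E} D"
    using part unfolding cone_partitionable_def by blast
  then have "finite D" unfolding cone_partition_def by blast
  \<comment> \<open>Distinctness is essential: the partition gives disjointness for different cones
    only, while a Stanley decomposition is indexed by positions.\<close>
  then obtain cs where cs: "set cs = D" "distinct cs" using finite_distinct_list by blast
  define ds where "ds = map (\<lambda>(u, Z). (Abs_poly_mapping u, Z)) cs"
  have len: "length ds = length cs" by (simp add: ds_def)
  have cone: "m \<in> monomial_cone (fst (ds ! i)) (snd (ds ! i)) \<longleftrightarrow>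
      Poly_Mapping.lookup m \<in> exponent_cone UNIV (cs ! i)" if "i < length cs" for i m
    using that unfolding monomial_cone_iff by (simp add: ds_def case_prod_beta lookup)
  have "m \<in> - E \<longleftrightarrow> m \<in> (\<Union>i<length ds. monomial_cone (fst (ds ! i)) (snd (ds ! i)))" for m
  proof -
    have "m \<in> - E \<longleftrightarrow> Poly_Mapping.lookup m \<in> {u. Abs_poly_mapping u \<notin> E}"
      by (simp add: lookup_inverse)
    also have "\<dots> \<longleftrightarrow> (\<exists>c\<in>set cs. Poly_Mapping.lookup m \<in> exponent_cone UNIV c)"
      using D unfolding cone_partition_def cs(1) by blast
    also have "\<dots> \<longleftrightarrow> (\<exists>i<length cs. Poly_Mapping.lookup m \<in> exponent_cone UNIV (cs ! i))"
      by (metis in_set_conv_nth)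
    finally show ?thesis using cone len by auto
  qed
  then have union: "- E = (\<Union>i<length ds. monomial_cone (fst (ds ! i)) (snd (ds ! i)))" by blast
  have disj: "disjoint_family_on (\<lambda>i. monomial_cone (fst (ds ! i)) (snd (ds ! i))) {..<length ds}"
    unfolding disjoint_family_on_def
  proof (intro ballI impI)
    fix i j assume ij: "i \<in> {..<length ds}" "j \<in> {..<length ds}" "i \<noteq> j"
    then have "cs ! i \<noteq> cs ! j" "cs ! i \<in> D" "cs ! j \<in> D"
      using cs len by (auto simp: nth_eq_iff_index_eq)
    then have "disjnt (exponent_cone UNIV (cs ! i)) (exponent_cone UNIV (cs ! j))"
      using D unfolding cone_partition_def pairwise_def by blast
    then show "monomial_cone (fst (ds ! i)) (snd (ds ! i)) \<inter>
        monomial_cone (fst (ds ! j)) (snd (ds ! j)) = {}"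
      using cone ij len by (auto simp: disjnt_iff)
  qed
  let ?D = "map (\<lambda>(m, Z). (I +>\<^bsub>\<S>\<^esub> monomial m, Z)) ds"
  have dec: "stanley_decomposition (quotient_module \<S> I) (quotient_component I) ?D"
    unfolding I_def by (rule stanley_decomposition_monomial_cones) (use I union disj in \<open>simp_all add: I_def\<close>)
  let ?A = "{sdepth_decomposition D | D. stanley_decomposition (quotient_module \<S> I) (quotient_component I) D}"
  \<comment> \<open>\<open>Max\<close> calls for a finite set. The empty list has depth
    \<open>Min {}\<close>, an unspecified number, which is therefore inserted separately.\<close>
  have "sdepth_decomposition D \<in> insert (Min {}) {..CARD('n)}"
    for D :: "(('n, 'k) mpoly set \<times> 'n set) list"
  proof (cases "D = []")
    case False
    then have "sdepth_decomposition D \<in> (\<lambda>(u, Z). card Z) ` set D"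
      unfolding sdepth_decomposition_def by (intro Min_in) auto
    then obtain Z :: "'n set" where "sdepth_decomposition D = card Z" by auto
    moreover have "card Z \<le> CARD('n)" by (intro card_mono) auto
    ultimately show ?thesis by simp
  qed (simp add: sdepth_decomposition_def)
  then have "finite ?A" by (intro finite_subset[of ?A "insert (Min {}) {..CARD('n)}"]) auto
  then have le: "sdepth_decomposition ?D \<le> sdepth_quotient I"
    unfolding sdepth_quotient_def sdepth_def using dec by (intro Max_ge) blast+
  \<comment> \<open>E is not everything, so the minimum defining the depth ranges over a nonempty
    set.\<close>
  have "ds \<noteq> []" using union proper by auto
  moreover have "d \<le> card Z" if "(m, Z) \<in> set ds" for m Z
    using that D cs(1) unfolding cone_partition_def ds_def by fastforce
  ultimately have "d \<le> sdepth_decomposition ?D"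
    unfolding sdepth_decomposition_def by (intro Min.boundedI) (auto simp: image_iff)
  then show ?thesis using le by simp
qed

lemma Inter_monomial_span: "(\<Inter>j\<in>J. monomial_span (E j)) = monomial_span (\<Inter>j\<in>J. E j)"
  by (auto simp: monomial_span_def)

theorem theorem2p8:
  fixes I :: "('n::finite, 'k::field) mpoly set"
    and Q :: "nat \<Rightarrow> ('n, 'k) mpoly set"
    and s :: nat
  assumes "monomial_ideal I"
    and "s \<ge> 2"
    and "\<And>j. j \<in> {1..s} \<Longrightarrow> irreducible_monomial_ideal (Q j)"
    and "irredundant_presentation s Q I"
    and "\<And>i \<tau>. i \<in> {1..s} \<Longrightarrow> \<tau> \<subset> {1..s} \<Longrightarrow> \<tau> \<noteq> {} \<Longrightarrow>
           ideal_radical \<S> (Q i) \<subseteq> ideal_sum \<S> (\<lambda>j. ideal_radical \<S> (Q j)) \<tau> \<Longrightarrow>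
           Q i \<subseteq> ideal_sum \<S> Q \<tau>"
  shows "ereal (real (sdepth_quotient I)) \<ge> ideal_size I"
proof -
  have "\<forall>j\<in>{1..s}. \<exists>G. (\<forall>(i, a)\<in>G. 1 \<le> a) \<and> Q j = power_ideal G"
    using assms(3) unfolding irreducible_monomial_ideal_iff by blast
  then obtain G where G: "\<And>j. j \<in> {1..s} \<Longrightarrow> \<forall>(i, a)\<in>G j. 1 \<le> a"
    and Q: "\<And>j. j \<in> {1..s} \<Longrightarrow> Q j = power_ideal (G j)" by metis
  define P where "P = (\<lambda>j. fst ` G j)"
  \<comment> \<open>Of several powers of k listed in \<open>G j\<close>, the least is the effective
    generator.\<close>
  define a where "a = (\<lambda>j k. LEAST b. (k, b) \<in> G j)"
  define U where "U = (\<Union>j\<in>{1..s}. P j)"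
  define E where "E = (\<Inter>j\<in>{1..s}. divisible (G j))"
  have a_mem: "(k, a j k) \<in> G j" if k: "k \<in> P j" for j k
  proof -
    have "\<exists>b. (k, b) \<in> G j" using k unfolding P_def by auto
    then show ?thesis unfolding a_def by (rule LeastI_ex)
  qed
  have a_le: "a j k \<le> b" if "(k, b) \<in> G j" for j k b
    unfolding a_def using that by (rule Least_le)
  have divisible: "m \<in> divisible (G j) \<longleftrightarrow> (\<exists>k\<in>P j. a j k \<le> Poly_Mapping.lookup m k)" for m j
  proof
    assume "m \<in> divisible (G j)"
    then obtain k b where kb: "(k, b) \<in> G j" "b \<le> Poly_Mapping.lookup m k"
      unfolding divisible_def by blast
    then have "a j k \<le> Poly_Mapping.lookup m k" "k \<in> P j"
      using a_le[OF kb(1)] unfolding P_def by (auto intro: rev_image_eqI)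
    then show "\<exists>k\<in>P j. a j k \<le> Poly_Mapping.lookup m k" by blast
  next
    assume "\<exists>k\<in>P j. a j k \<le> Poly_Mapping.lookup m k"
    then show "m \<in> divisible (G j)" using a_mem unfolding divisible_def by blast
  qed
  have G_Union: "\<forall>(i, a)\<in>(\<Union>j\<in>\<sigma>. G j). 1 \<le> a" if "\<sigma> \<subseteq> {1..s}" for \<sigma>
    using G that by blast
  have sum_Q: "ideal_sum \<S> Q \<sigma> = power_ideal (\<Union>j\<in>\<sigma>. G j)" if "\<sigma> \<subseteq> {1..s}" for \<sigma>
  proof -
    have "ideal_sum \<S> Q \<sigma> = ideal_sum \<S> (\<lambda>j. power_ideal (G j)) \<sigma>"
      by (rule ideal_sum_cong) (use Q that in blast)
    then show ?thesis unfolding ideal_sum_power_ideals .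
  qed
  have rad_Q: "rad (Q j) = power_ideal (P j \<times> {1})" if "j \<in> {1..s}" for j
    unfolding Q[OF that] P_def by (rule radical_power_ideal[OF G[OF that]])

  have I: "I = monomial_span E"
    using assms(4) Q unfolding irredundant_presentation_def E_def Inter_monomial_span[symmetric] by simp
  have "ideal I \<S>"
    unfolding I by (rule monomial_span_ideal) (auto simp: E_def intro: divisible_add)
  have "(0 :: 'n \<Rightarrow>\<^sub>0 nat) \<notin> divisible (G 1)"
    using G[of 1] assms(2) unfolding divisible_def by fastforce
  then have "E \<noteq> UNIV" using assms(2) unfolding E_def by force

  define v where "v = size_v s Q"
  \<comment> \<open>This is v + n - h - 1 with card U in place of h; the natural-number subtraction
    is exact by \<open>v_pos\<close> and \<open>cardU\<close>.\<close>
  define d where "d = v + CARD('n) - card U - 1"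
  \<comment> \<open>The radical of a sum of components is generated by the variables that occur, so
    a cover of U by t components is admissible in the minimum defining
    \<open>size_v\<close>.\<close>
  have v_le: "v \<le> t" if "1 \<le> t" "j ` {1..t} \<subseteq> {1..s}" "(\<Union>i\<in>{1..t}. P (j i)) = U" for t j
  proof -
    have 1: "rad (power_ideal (\<Union>i\<in>\<sigma>. G i)) = (power_ideal ((\<Union>i\<in>\<sigma>. P i) \<times> {1}) :: ('n, 'k) mpoly set)"
      if "\<sigma> \<subseteq> {1..s}" for \<sigma>
      using radical_power_ideal[OF G_Union[OF that]] by (simp add: image_UN P_def)
    have "ideal_sum \<S> (\<lambda>i. Q (j i)) {1..t} = ideal_sum \<S> Q (j ` {1..t})"
      by (simp add: ideal_sum_def)
    then have "rad (ideal_sum \<S> (\<lambda>i. Q (j i)) {1..t}) = power_ideal (U \<times> {1})"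
      using sum_Q[OF that(2)] 1[OF that(2)] that(3) by simp
    moreover have "rad (ideal_sum \<S> Q {1..s}) = power_ideal (U \<times> {1})"
      using sum_Q[OF order_refl] 1[OF order_refl] by (simp add: U_def)
    ultimately show ?thesis
      unfolding v_def size_v_def using that(1,2) by (intro Least_le) metis
  qed
  have v_pos: "1 \<le> v"
  proof -
    have "\<exists>t\<ge>1. \<exists>j :: nat \<Rightarrow> nat. j ` {1..t} \<subseteq> {1..s} \<and>
        rad (ideal_sum \<S> (\<lambda>i. Q (j i)) {1..t}) = rad (ideal_sum \<S> Q {1..s})"
      using assms(2) by (intro exI[of _ s] exI[of _ "\<lambda>i. i"]) auto
    from LeastI_ex[OF this] show ?thesis unfolding v_def size_v_def by blast
  qed
  have cardU: "card U \<le> CARD('n)" by (rule card_mono) auto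
  then have d: "d + 1 + card U = v + CARD('n)" using v_pos unfolding d_def by linarith

  have "cone_partitionable UNIV d (outside {1..s} P a)"
  proof (rule outside_partitionable)
    fix i \<sigma> assume i: "i \<in> {1..s}" and \<sigma>: "\<sigma> \<subseteq> {1..s}" and cov: "P i \<subseteq> (\<Union>j\<in>\<sigma>. P j)"
    show "\<forall>k\<in>P i. \<exists>j\<in>\<sigma>. k \<in> P j \<and> a j k \<le> a i k"
    \<comment> \<open>The hypothesis speaks of proper nonempty sets. In the empty case
      \<open>P i\<close> is empty, and in the full case i itself is the witness.\<close>
    proof (cases "\<sigma> = {} \<or> \<sigma> = {1..s}")
      case True
      then show ?thesis using i cov by blast
    next
      case False
      have "ideal_sum \<S> (\<lambda>j. rad (Q j)) \<sigma> = ideal_sum \<S> (\<lambda>j. power_ideal (P j \<times> {1})) \<sigma>"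
        by (rule ideal_sum_cong) (use rad_Q \<sigma> in blast)
      then have "ideal_sum \<S> (\<lambda>j. rad (Q j)) \<sigma> = power_ideal (\<Union>j\<in>\<sigma>. P j \<times> {1})"
        unfolding ideal_sum_power_ideals .
      moreover have "divisible (P i \<times> {1}) \<subseteq> divisible (\<Union>j\<in>\<sigma>. P j \<times> {1})"
        using cov unfolding divisible_def by blast
      ultimately have "rad (Q i) \<subseteq> ideal_sum \<S> (\<lambda>j. rad (Q j)) \<sigma>"
        unfolding rad_Q[OF i] by (auto simp: monomial_span_def)
      then have "Q i \<subseteq> ideal_sum \<S> Q \<sigma>" using assms(5)[OF i] False \<sigma> by blast
      then have sub: "power_ideal (G i) \<subseteq> (power_ideal (\<Union>j\<in>\<sigma>. G j) :: ('n, 'k) mpoly set)"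
        unfolding sum_Q[OF \<sigma>] Q[OF i] .
      show ?thesis
      proof
        fix k assume k: "k \<in> P i"
        \<comment> \<open>The generator of \<open>Q i\<close> in the variable k lies in the sum, so
          a generator of some component in \<sigma> divides it; having positive exponent, that
          generator is a power of the same variable.\<close>
        let ?x = "Poly_Mapping.single k (a i k)"
        have "?x \<in> divisible (G i)" unfolding divisible using k by (intro bexI[of _ k]) simp_all
        then have "monomial ?x \<in> (power_ideal (G i) :: ('n, 'k) mpoly set)"
          by (simp add: monomial_span_def monomial_def)
        then have "monomial ?x \<in> (power_ideal (\<Union>j\<in>\<sigma>. G j) :: ('n, 'k) mpoly set)"
          using sub by blast
        then have "?x \<in> divisible (\<Union>j\<in>\<sigma>. G j)"
          by (simp add: monomial_span_def monomial_def)
        then obtain j l b where jlb: "j \<in> \<sigma>" "(l, b) \<in> G j" "b \<le> Poly_Mapping.lookup ?x l"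
          unfolding divisible_def by blast
        have "1 \<le> b" using G_Union[OF \<sigma>] jlb by blast
        then have "l = k" using jlb(3) by (auto simp: lookup_single when_def split: if_splits)
        then have "k \<in> P j" "a j k \<le> a i k"
          using jlb a_le[of k b j] unfolding P_def by (auto intro: rev_image_eqI)
        then show "\<exists>j\<in>\<sigma>. k \<in> P j \<and> a j k \<le> a i k" using jlb(1) by blast
      qed
    qed
  next
    fix \<sigma> assume \<sigma>: "\<sigma> \<subseteq> {1..s}" "\<sigma> \<noteq> {}" and cov: "(\<Union>j\<in>\<sigma>. P j) = (\<Union>j\<in>{1..s}. P j)"
    have fin: "finite \<sigma>" using \<sigma>(1) finite_subset by blast
    then obtain f where f: "bij_betw f {1..card \<sigma>} \<sigma>" using ex_bij_betw_nat_finite_1 by blast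
    then have img: "f ` {1..card \<sigma>} = \<sigma>" by (simp add: bij_betw_def)
    have "v \<le> card \<sigma>"
    proof (rule v_le)
      show "1 \<le> card \<sigma>" using fin \<sigma>(2) by (simp add: Suc_le_eq card_gt_0_iff)
      show "f ` {1..card \<sigma>} \<subseteq> {1..s}" using img \<sigma>(1) by simp
      have "(\<Union>i\<in>{1..card \<sigma>}. P (f i)) = (\<Union>j\<in>f ` {1..card \<sigma>}. P j)" by simp
      then show "(\<Union>i\<in>{1..card \<sigma>}. P (f i)) = U" unfolding img cov U_def .
    qed
    then show "d + 1 + card (\<Union>j\<in>{1..s}. P j) \<le> card \<sigma> + CARD('n)"
      using d unfolding U_def by linarith
  qed auto
  moreover have "outside {1..s} P a = {u. Abs_poly_mapping u \<notin> E}"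
    unfolding outside_def E_def by (auto simp: divisible not_le)
  ultimately have "d \<le> sdepth_quotient I"
    unfolding I using \<open>ideal I \<S>\<close> \<open>E \<noteq> UNIV\<close> by (intro sdepth_quotient_ge) (simp_all add: I)
  moreover have "ideal_size I \<le> ereal (real d)"
  proof -
    have "monomial_ideal (Q j) \<and> primary_ideal \<S> (Q j)" if "j \<in> {1..s}" for j
      unfolding Q[OF that] using primary_power_ideal[OF G[OF that]] monomial_ideal_power_ideal by blast
    then have "monomial_primary_decomposition s Q I"
      unfolding monomial_primary_decomposition_def using assms(2,4) by simp
    then have "ideal_size I = decomposition_size s Q" by (rule ideal_size_eq)
    \<comment> \<open>The height is subtracted in the size, so replacing it by the smaller card U
      gives an upper bound.\<close>
    moreover have "ereal_of_enat (enat (card U)) \<le> ereal_of_enat (height \<S> (ideal_sum \<S> Q {1..s}))"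
    proof -
      have "fst ` (\<Union>j\<in>{1..s}. G j) = U" by (simp add: U_def P_def image_UN)
      then show ?thesis
        using height_ge[OF G_Union[OF order_refl]] unfolding sum_Q[OF order_refl] ereal_of_enat_le_iff by simp
    qed
    then have "decomposition_size s Q \<le> ereal (real v) + ereal (real CARD('n)) - ereal_of_enat (enat (card U)) - 1"
      unfolding decomposition_size_def v_def[symmetric] by (intro ereal_minus_mono order_refl)
    moreover have "\<dots> = ereal (real d)"
    proof -
      have "real d = real v + real CARD('n) - real (card U) - 1" using d by linarith
      then show ?thesis by (simp add: one_ereal_def)
    qed
    ultimately show ?thesis by simp
  qed
  ultimately show ?thesis
    by (meson ereal_less_eq(3) of_nat_le_iff order_trans)
qed

end
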